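(* Let $0<p,q<1$ and $\varepsilon_m=m^{-p}$ for integers $m\ge3$. For each $m$ let $\pi_1,\dots,\pi_m\in(0,1]$ (possibly depending on $m$), and consider the hypotheses $H_0$ and $H_1^{(\mathrm{mix})}$ and the higher criticism statistic $\mathrm{HC}^*_m$ defined in the context. If $q+2p<1$ and, for every $m$, $\pi_t<1-m^{-q}$ for all $t=1,\dots,m$, then for any constant $\delta>0$ the decision rule that rejects $H_0$ if and only if $\mathrm{HC}^*_m\ge\sqrt{(2+\delta)\log\log m}$ has its sum of type I and type II error probabilities tend to $0$ as $m\to\infty$.
   Context: Hypotheses. For each $m$ one observes $\zeta_1,\dots,\zeta_m\in[0,1]$. Under $H_0$, $\zeta_1,\dots,\zeta_m$ are i.i.d. $U[0,1]$. Under $H_1^{(\mathrm{mix})}$, $\zeta_1,\dots,\zeta_m$ are independent and $\zeta_t\sim(1-\varepsilon_m)U[0,1]+\varepsilon_m U[0,\pi_t]$ (a mixture distribution), where $\pi_t\in(0,1]$ are given numbers. (In the watermarking application $\pi_t=P_{t,\mathcal{G}_t}=\sum_{w\in\mathcal{G}_t}P_{t,w}$ is the total next-token probability of the green list $\mathcal{G}_t$ at step $t$; one conditions on these quantities.) Type I error is the probability under $H_0$ of rejecting $H_0$; type II error is the probability under $H_1^{(\mathrm{mix})}$ of not rejecting $H_0$. Higher criticism. Let $\zeta_{(1)}<\zeta_{(2)}<\dots<\zeta_{(m)}$ be the values $\zeta_1,\dots,\zeta_m$ in ascending order (almost surely distinct and in $(0,1)$). Define $$\mathrm{HC}^*_m=\max_{1\le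 t\le m}\mathrm{HC}_{m,t},\qquad \mathrm{HC}_{m,t}=\sqrt{m}\cdot\frac{t/m-\zeta_{(t)}}{\sqrt{\zeta_{(t)}(1-\zeta_{(t)})}}.$$ *)

theory Defs
  imports "HOL-Probability.Probability"
begin

definition uniform_law :: "real \<Rightarrow> real measure" where
  "uniform_law a = uniform_measure lborel {0..a}"

text \<open>The mixture \<open>(1 - e) M + e N\<close> of two measures on the same measurable space.\<close>

definition mixture :: "real \<Rightarrow> 'a measure \<Rightarrow> 'a measure \<Rightarrow> 'a measure" where
  "mixture e M N = measure_of (space M) (sets M)
     (\<lambda>A. ennreal (1 - e) * emeasure M A + ennreal e * emeasure N A)"

text \<open>The joint laws of the observations \<open>z 1, \<dots>, z m\<close>.\<close>

definition H0_law :: "nat \<Rightarrow> (nat \<Rightarrow> real) measure" where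
  "H0_law m = PiM {1..m} (\<lambda>t. uniform_law 1)"

definition H1_mix_law :: "nat \<Rightarrow> real \<Rightarrow> (nat \<Rightarrow> real) \<Rightarrow> (nat \<Rightarrow> real) measure" where
  "H1_mix_law m e \<pi> = PiM {1..m} (\<lambda>t. mixture e (uniform_law 1) (uniform_law (\<pi> t)))"

definition order_stat :: "nat \<Rightarrow> (nat \<Rightarrow> real) \<Rightarrow> nat \<Rightarrow> real" where
  "order_stat m z t = sort (map z [1..<Suc m]) ! (t - 1)"

text \<open>On the null event that some observation is 0 or 1 the quotient below follows the convention
  \<open>x / 0 = 0\<close>.\<close>

definition HC :: "nat \<Rightarrow> (nat \<Rightarrow> real) \<Rightarrow> nat \<Rightarrow> real" where
  "HC m z t = sqrt (real m) *
     ((real t / real m - order_stat m z t) / sqrt (order_stat m z t * (1 - order_stat m z t)))"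

definition HC_star :: "nat \<Rightarrow> (nat \<Rightarrow> real) \<Rightarrow> real" where
  "HC_star m z = Max (HC m z ` {1..m})"

definition HC_rejects :: "real \<Rightarrow> nat \<Rightarrow> (nat \<Rightarrow> real) \<Rightarrow> bool" where
  "HC_rejects \<delta> m z \<longleftrightarrow> HC_star m z \<ge> sqrt ((2 + \<delta>) * ln (ln (real m)))"

definition type_I_error :: "nat \<Rightarrow> ((nat \<Rightarrow> real) \<Rightarrow> bool) \<Rightarrow> real" where
  "type_I_error m rejects = measure (H0_law m) {z \<in> space (H0_law m). rejects z}"

definition type_II_error ::
    "nat \<Rightarrow> real \<Rightarrow> (nat \<Rightarrow> real) \<Rightarrow> ((nat \<Rightarrow> real) \<Rightarrow> bool) \<Rightarrow> real" where
  "type_II_error m e \<pi> rejects =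
     measure (H1_mix_law m e \<pi>) {z \<in> space (H1_mix_law m e \<pi>). \<not> rejects z}"

text \<open>The set function in \<^const>\<open>mixture\<close> is a measure, so \<^const>\<open>measure_of\<close> does not
  collapse to the null measure.\<close>

lemma space_mixture [simp]: "space (mixture e M N) = space M"
  by (simp add: mixture_def)

lemma sets_mixture [simp, measurable_cong]: "sets (mixture e M N) = sets M"
  by (simp add: mixture_def)

lemma emeasure_mixture:
  assumes "sets M = sets N" "A \<in> sets M"
  shows "emeasure (mixture e M N) A = ennreal (1 - e) * emeasure M A + ennreal e * emeasure N A"
proof (rule emeasure_measure_of[OF mixture_def])
  show "countably_additive (sets (mixture e M N))
      (\<lambda>A. ennreal (1 - e) * emeasure M A + ennreal e * emeasure N A)"
  proof (rule countably_additiveI)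
    fix F :: "nat \<Rightarrow> 'a set"
    assume F: "range F \<subseteq> sets (mixture e M N)" "disjoint_family F"
    then have M: "range F \<subseteq> sets M" and N: "range F \<subseteq> sets N"
      using assms(1) by simp_all
    show "(\<Sum>i. ennreal (1 - e) * emeasure M (F i) + ennreal e * emeasure N (F i)) =
        ennreal (1 - e) * emeasure M (\<Union>i. F i) + ennreal e * emeasure N (\<Union>i. F i)"
      using suminf_emeasure[OF M F(2)] suminf_emeasure[OF N F(2)]
      by (simp add: suminf_add[symmetric])
  qed
qed (use assms in \<open>auto simp: positive_def dest: sets.sets_into_space\<close>)

lemma sets_uniform_law [simp, measurable_cong]: "sets (uniform_law a) = sets borel"
  by (simp add: uniform_law_def)

lemma space_uniform_law [simp]: "space (uniform_law a) = UNIV"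
  by (simp add: uniform_law_def)

lemma prob_space_uniform_law: "a > 0 \<Longrightarrow> prob_space (uniform_law a)"
  unfolding uniform_law_def by (rule prob_space_uniform_measure) auto

lemma prob_space_mixture:
  assumes "prob_space M" "prob_space N" "sets M = sets N" "0 \<le> e" "e \<le> 1"
  shows "prob_space (mixture e M N)"
proof
  have "emeasure M (space M) = 1" "emeasure N (space M) = 1"
    using prob_space.emeasure_space_1[OF assms(1)] prob_space.emeasure_space_1[OF assms(2)]
      sets_eq_imp_space_eq[OF assms(3)] by simp_all
  then show "emeasure (mixture e M N) (space (mixture e M N)) = 1"
    using assms(4,5) emeasure_mixture[OF assms(3) sets.top, of e] by (simp flip: ennreal_plus)
qed

text \<open>The rejection region is measurable, so both error probabilities are genuine
  probabilities.\<close>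

lemma sorted_nth_le_iff:
  fixes xs :: "'a::linorder list"
  assumes "sorted xs" "k < length xs"
  shows "xs ! k \<le> x \<longleftrightarrow> k < length (filter (\<lambda>y. y \<le> x) xs)"
  using assms
proof (induction xs arbitrary: k)
  case (Cons a xs)
  show ?case
  proof (cases "a \<le> x")
    case True
    then show ?thesis using Cons by (cases k) auto
  next
    case False
    with Cons.prems have "\<forall>y \<in> set (a # xs). \<not> y \<le> x" by auto
    moreover then have "filter (\<lambda>y. y \<le> x) (a # xs) = []" by (simp add: filter_empty_conv)
    ultimately show ?thesis using nth_mem[OF Cons.prems(2)] by auto
  qed
qed simp

lemma order_stat_le_iff:
  assumes "t \<in> {1..m}"
  shows "order_stat m z t \<le> x \<longleftrightarrow> real t \<le> (\<Sum>i\<in>{1..m}. if z i \<le> x then 1 else 0)"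
proof -
  have "length (filter (\<lambda>y. y \<le> x) (sort (map z [1..<Suc m]))) =
      length (filter (\<lambda>i. z i \<le> x) [1..<Suc m])"
    by (simp add: filter_sort filter_map comp_def del: upt_Suc)
  also have "\<dots> = card {i \<in> {1..m}. z i \<le> x}"
    by (subst distinct_card[symmetric]) (auto intro!: arg_cong[where f=card])
  finally have *: "order_stat m z t \<le> x \<longleftrightarrow> t - 1 < card {i \<in> {1..m}. z i \<le> x}"
    unfolding order_stat_def using assms by (subst sorted_nth_le_iff) auto
  have "(\<Sum>i\<in>{1..m}. if z i \<le> x then 1 else 0 :: real) = real (card {i \<in> {1..m}. z i \<le> x})"
    by (simp add: sum.If_cases Int_def)
  with * assms show ?thesis by auto
qed

lemma measurable_order_stat:
  assumes "t \<in> {1..m}"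
  shows "(\<lambda>z. order_stat m z t) \<in> borel_measurable (PiM {1..m} (\<lambda>_. borel))"
proof (rule borel_measurableI_le)
  fix x
  show "{z \<in> space (PiM {1..m} (\<lambda>_. borel)). order_stat m z t \<le> x} \<in> sets (PiM {1..m} (\<lambda>_. borel))"
    unfolding order_stat_le_iff[OF assms] by measurable
qed

lemma measurable_HC_star:
  assumes "m \<ge> 1"
  shows "HC_star m \<in> borel_measurable (PiM {1..m} (\<lambda>_. borel))"
proof -
  have "(\<lambda>z. HC m z t) \<in> borel_measurable (PiM {1..m} (\<lambda>_. borel))" if "t \<in> {1..m}" for t
    using measurable_order_stat[OF that] unfolding HC_def by measurable
  then have "(\<lambda>z. Max ((\<lambda>t. HC m z t) ` {1..m})) \<in> borel_measurable (PiM {1..m} (\<lambda>_. borel))"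
    by (intro borel_measurable_Max) auto
  then show ?thesis by (simp add: HC_star_def[abs_def])
qed

lemma HC_rejects_measurable:
  assumes "m \<ge> 1"
  shows "{z \<in> space (H0_law m). HC_rejects \<delta> m z} \<in> sets (H0_law m)"
    and "{z \<in> space (H1_mix_law m e \<pi>). \<not> HC_rejects \<delta> m z} \<in> sets (H1_mix_law m e \<pi>)"
proof -
  have "sets (H0_law m) = sets (PiM {1..m} (\<lambda>_. borel))"
    unfolding H0_law_def by (intro sets_PiM_cong) auto
  moreover have "sets (H1_mix_law m e \<pi>) = sets (PiM {1..m} (\<lambda>_. borel))"
    unfolding H1_mix_law_def by (intro sets_PiM_cong) auto
  ultimately have [measurable]: "HC_star m \<in> borel_measurable (H0_law m)"
      "HC_star m \<in> borel_measurable (H1_mix_law m e \<pi>)"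
    using measurable_HC_star[OF assms] by (simp_all cong: measurable_cong_sets)
  show "{z \<in> space (H0_law m). HC_rejects \<delta> m z} \<in> sets (H0_law m)"
    "{z \<in> space (H1_mix_law m e \<pi>). \<not> HC_rejects \<delta> m z} \<in> sets (H1_mix_law m e \<pi>)"
    unfolding HC_rejects_def by measurable
qed

end

theory Submission
  imports Defs "HOL-Real_Asymp.Real_Asymp"
begin

text \<open>Type I. Let \<open>N u\<close> be the number of observations \<open>\<le> u\<close> and \<open>x = sqrt ((2 + \<delta>) log log m)\<close>. Under
  the null hypothesis \<open>N u / u\<close> is a reverse martingale in \<open>u\<close>, so Doob's inequality for
  \<open>exp (s N u / u)\<close> controls the deviation of the empirical process on a whole block \<open>[a, (1 + e) a]\<close>
  by the exponential moment at the single point \<open>a\<close>. In the range where \<open>m u\<close> is much larger than \<open>x\<^sup>2\<close>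
  and \<open>u \<le> e\<close> this is \<open>exp (- (1 - o(1)) x\<^sup>2 / 2) \<le> (log m) powr (- 1 - \<delta> / 4)\<close>, which beats the
  \<open>O(log m)\<close> blocks needed; the remaining ranges need only \<open>O(log x)\<close> or \<open>O(1)\<close> blocks, for which cruder
  Poisson rates suffice, and below \<open>1 / (x m)\<close> there is typically no observation at all. The range near
  \<open>1\<close> is handled in the same way by counting the observations \<open>> u\<close>; there the deviation is downwards
  and the bound is purely sub-Gaussian.

  Type II. At \<open>u = 1 - m powr (- q)\<close>, to the right of all \<open>\<pi> t\<close>, the mean of \<open>N u\<close> exceeds \<open>m u\<close> by
  \<open>m \<epsilon> (1 - u)\<close>, which is \<open>m powr ((1 - q) / 2 - p)\<close> standard deviations; a Chernoff bound shows that half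
  of this excess is present with probability tending to \<open>1\<close>.\<close>

section \<open>A maximal inequality for counts in nested sets\<close>

text \<open>Convexity of \<open>exp\<close>: \<open>s / v\<close> is the average of 0 and
  \<open>s / u\<close> with weight \<open>u / v\<close> on the latter. For a single observation this
  is the submartingale step from level \<open>v\<close> down to level \<open>u\<close>;
  \<open>s\<close> may have either sign.\<close>

lemma exp_weight_mono:
  fixes s u v :: real
  assumes "0 < u" "u \<le> v"
  shows "v * exp (s / v) \<le> v - u + u * exp (s / u)"
proof -
  define p where "p = u / v"
  have p: "0 \<le> p" "p \<le> 1" using assms by (auto simp: p_def)
  have "exp ((1 - p) *\<^sub>R 0 + p *\<^sub>R (s / u)) \<le> (1 - p) * exp 0 + p * exp (s / u)"
    by (rule convex_onD[OF exp_convex]) (use p in auto)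
  then have "v * exp (p * (s / u)) \<le> v * ((1 - p) + p * exp (s / u))"
    using assms by (intro mult_left_mono) auto
  also have "\<dots> = v - u + u * exp (s / u)"
    using assms by (simp add: p_def field_simps)
  finally show ?thesis using assms by (simp add: p_def)
qed

text \<open>Conditioning on the cells \<open>max (d i) j\<close>, that is, forgetting the order of the points below level \<open>j\<close>.\<close>

lemma sum_PiE_collapse:
  fixes f :: "'i \<Rightarrow> nat \<Rightarrow> real"
  assumes "finite I" "j \<le> L"
    and g: "\<And>d d'. (\<And>i. i \<in> I \<Longrightarrow> max (d i) j = max (d' i) j) \<Longrightarrow> g d = g d'"
  shows "(\<Sum>d\<in>PiE I (\<lambda>_. {..L}). g d * (\<Prod>i\<in>I. f i (d i)))
       = (\<Sum>e\<in>PiE I (\<lambda>_. {j..L}). g e * (\<Prod>i\<in>I. if e i = j then \<Sum>c\<le>j. f i c else f i (e i)))"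
proof -
  let ?D = "PiE I (\<lambda>_. {..L})" and ?E = "PiE I (\<lambda>_. {j..L})"
  let ?r = "\<lambda>d. restrict (\<lambda>i. max (d i) j) I"
  let ?B = "\<lambda>e i. if e i = j then {..j} else {e i}"
  \<comment> \<open>The fibre of the collapsing map over \<open>e\<close> is again a product:
    \<open>{..j}\<close> in the coordinates with \<open>e i = j\<close>, a singleton in the others.
    This lets the inner sum factor.\<close>
  have fib: "{d \<in> ?D. ?r d = e} = PiE I (?B e)" if e: "e \<in> ?E" for e
  proof (intro set_eqI iffI)
    fix d assume "d \<in> {d \<in> ?D. ?r d = e}"
    then have d: "d \<in> ?D" "?r d = e" by auto
    have "e i = max (d i) j" if "i \<in> I" for i using d(2) that by auto
    then have "d i \<in> ?B e i" if "i \<in> I" for i using that by (auto simp: max_def)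
    with d(1) show "d \<in> PiE I (?B e)" by (simp add: PiE_iff)
  next
    fix d assume d: "d \<in> PiE I (?B e)"
    then have di: "d i \<in> ?B e i" if "i \<in> I" for i using that by (rule PiE_mem)
    have "d i \<le> L" if "i \<in> I" for i
      using di[OF that] PiE_mem[OF e that] \<open>j \<le> L\<close> by (auto split: if_splits)
    then have "d \<in> ?D" using d by (simp add: PiE_iff)
    moreover have "?r d i = e i" for i
      using di[of i] e by (cases "i \<in> I") (auto simp: PiE_iff extensional_def split: if_splits)
    ultimately show "d \<in> {d \<in> ?D. ?r d = e}" by auto
  qed
  have "(\<Sum>d\<in>?D. g d * (\<Prod>i\<in>I. f i (d i)))
      = (\<Sum>e\<in>?E. \<Sum>d\<in>{d \<in> ?D. ?r d = e}. g d * (\<Prod>i\<in>I. f i (d i)))"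
    by (rule sum.group[symmetric]) (use assms in \<open>auto intro!: finite_PiE simp: PiE_iff\<close>)
  also have "\<dots> = (\<Sum>e\<in>?E. g e * (\<Prod>i\<in>I. \<Sum>c\<in>?B e i. f i c))"
  proof (rule sum.cong[OF refl])
    fix e assume e: "e \<in> ?E"
    have "g d = g e" if "d \<in> {d \<in> ?D. ?r d = e}" for d
      by (rule g) (use that e in \<open>auto simp: PiE_iff\<close>)
    then have "(\<Sum>d\<in>{d \<in> ?D. ?r d = e}. g d * (\<Prod>i\<in>I. f i (d i)))
        = g e * (\<Sum>d\<in>{d \<in> ?D. ?r d = e}. \<Prod>i\<in>I. f i (d i))"
      by (simp add: sum_distrib_left)
    also have "(\<Sum>d\<in>{d \<in> ?D. ?r d = e}. \<Prod>i\<in>I. f i (d i)) = (\<Prod>i\<in>I. \<Sum>c\<in>?B e i. f i c)"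
      unfolding fib[OF e] by (subst prod_sum_PiE) (use assms in auto)
    finally show "(\<Sum>d\<in>{d \<in> ?D. ?r d = e}. g d * (\<Prod>i\<in>I. f i (d i)))
        = g e * (\<Prod>i\<in>I. \<Sum>c\<in>?B e i. f i c)" .
  qed
  also have "\<dots> = (\<Sum>e\<in>?E. g e * (\<Prod>i\<in>I. if e i = j then \<Sum>c\<le>j. f i c else f i (e i)))"
    by (intro sum.cong refl arg_cong2[where f = "(*)"] prod.cong) auto
  finally show ?thesis .
qed

text \<open>Observation \<open>i\<close> falls into cell \<open>c\<close> with probability \<open>w i c\<close>. The first passage is taken from the
  top level downwards, along which the exponential of \<open>s / W j\<close> times the count is a submartingale.\<close>

lemma cell_count_maximal_inequality:
  fixes w :: "'i \<Rightarrow> nat \<Rightarrow> real" and W :: "nat \<Rightarrow> real" and s l :: real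
  assumes I: "finite I"
    and w: "\<And>i c. i \<in> I \<Longrightarrow> 0 \<le> w i c"
    and W: "\<And>i j. i \<in> I \<Longrightarrow> j \<le> L \<Longrightarrow> (\<Sum>c\<le>j. w i c) = W j"
    and pos: "0 < W 0" and mono: "\<And>j. j \<le> L \<Longrightarrow> W 0 \<le> W j"
  shows "(\<Sum>d | d \<in> PiE I (\<lambda>_. {..L}) \<and> (\<exists>j\<le>L. l \<le> s * real (card {i \<in> I. d i \<le> j}) / W j).
            \<Prod>i\<in>I. w i (d i))
         \<le> exp (- l) * (W L - W 0 + W 0 * exp (s / W 0)) ^ card I"
proof -
  let ?D = "PiE I (\<lambda>_. {..L})"
  define N where "N j d = real (card {i \<in> I. d i \<le> j})" for j and d :: "'i \<Rightarrow> nat"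
  define p where "p d = (\<Prod>i\<in>I. w i (d i))" for d
  define X where "X j d = exp (s * N j d / W j)" for j d
  define T where "T j = {d \<in> ?D. l \<le> s * N j d / W j \<and> (\<forall>k\<in>{j<..L}. \<not> l \<le> s * N k d / W k)}" for j
  have finD: "finite ?D" using I by (auto intro!: finite_PiE)
  have p0: "0 \<le> p d" for d unfolding p_def by (intro prod_nonneg) (use w in auto)
  have Xprod: "X j d = (\<Prod>i\<in>I. if d i \<le> j then exp (s / W j) else 1)" for j d
  proof -
    have "(\<Prod>i\<in>I. if d i \<le> j then exp (s / W j) else 1) = (\<Prod>i\<in>{i \<in> I. d i \<le> j}. exp (s / W j))"
      by (rule prod.inter_filter[OF I, symmetric])
    then show ?thesis by (simp add: X_def N_def exp_of_nat_mult[symmetric] mult.commute)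
  qed
  \<comment> \<open>Submartingale comparison of level \<open>j\<close> with level 0, weighted by a
    function of the cells as seen from level \<open>j\<close> upwards. After collapsing, the factors
    with \<open>e i > j\<close> agree, and those with \<open>e i = j\<close> compare by
    \<open>exp_weight_mono\<close>.\<close>
  have step: "(\<Sum>d\<in>?D. g d * (p d * X j d)) \<le> (\<Sum>d\<in>?D. g d * (p d * X 0 d))"
    if j: "j \<le> L" and g: "\<And>d d'. (\<And>i. i \<in> I \<Longrightarrow> max (d i) j = max (d' i) j) \<Longrightarrow> g d = g d'"
      and g0: "\<And>d. 0 \<le> g d" for g j
  proof -
    have "(\<Sum>d\<in>?D. g d * (p d * X j d))
        = (\<Sum>d\<in>?D. g d * (\<Prod>i\<in>I. w i (d i) * (if d i \<le> j then exp (s / W j) else 1)))"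
      by (simp add: p_def Xprod prod.distrib)
    also have "\<dots> = (\<Sum>e\<in>PiE I (\<lambda>_. {j..L}). g e * (\<Prod>i\<in>I. if e i = j
        then \<Sum>c\<le>j. w i c * (if c \<le> j then exp (s / W j) else 1)
        else w i (e i) * (if e i \<le> j then exp (s / W j) else 1)))"
      by (rule sum_PiE_collapse[OF I j g, where f = "\<lambda>i c. w i c * (if c \<le> j then exp (s / W j) else 1)"])
    also have "\<dots> \<le> (\<Sum>e\<in>PiE I (\<lambda>_. {j..L}). g e * (\<Prod>i\<in>I. if e i = j
        then \<Sum>c\<le>j. w i c * (if c \<le> 0 then exp (s / W 0) else 1)
        else w i (e i) * (if e i \<le> 0 then exp (s / W 0) else 1)))"
    proof (intro sum_mono mult_left_mono g0 prod_mono conjI)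
      fix e i assume e: "e \<in> PiE I (\<lambda>_. {j..L})" and i: "i \<in> I"
      then have ei: "j \<le> e i" by (auto simp: PiE_iff)
      show "0 \<le> (if e i = j then \<Sum>c\<le>j. w i c * (if c \<le> j then exp (s / W j) else 1)
        else w i (e i) * (if e i \<le> j then exp (s / W j) else 1))"
        using w[OF i] by (auto intro!: sum_nonneg)
      have w0: "w i 0 = W 0" using W[OF i, of 0] by simp
      have "(\<Sum>c\<le>j. w i c * (if c \<le> j then exp (s / W j) else 1)) = W j * exp (s / W j)"
        using W[OF i j] by (simp flip: sum_distrib_right)
      also have "\<dots> \<le> W j - W 0 + W 0 * exp (s / W 0)"
        by (rule exp_weight_mono) (use pos mono j in auto)
      also have "\<dots> = (\<Sum>c\<le>j. w i c * (if c \<le> 0 then exp (s / W 0) else 1))"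
        using W[OF i j] w0 by (simp add: sum.atMost_shift)
      finally show "(if e i = j then \<Sum>c\<le>j. w i c * (if c \<le> j then exp (s / W j) else 1)
          else w i (e i) * (if e i \<le> j then exp (s / W j) else 1))
        \<le> (if e i = j then \<Sum>c\<le>j. w i c * (if c \<le> 0 then exp (s / W 0) else 1)
          else w i (e i) * (if e i \<le> 0 then exp (s / W 0) else 1))"
        using ei by auto
    qed
    also have "\<dots> = (\<Sum>d\<in>?D. g d * (\<Prod>i\<in>I. w i (d i) * (if d i \<le> 0 then exp (s / W 0) else 1)))"
      by (rule sum_PiE_collapse[OF I j g, symmetric,
            where f = "\<lambda>i c. w i c * (if c \<le> 0 then exp (s / W 0) else 1)"])
    also have "\<dots> = (\<Sum>d\<in>?D. g d * (p d * X 0 d))"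
      by (simp add: p_def Xprod prod.distrib)
    finally show ?thesis .
  qed
  have T_step: "exp l * (\<Sum>d\<in>T j. p d) \<le> (\<Sum>d\<in>T j. p d * X 0 d)" if j: "j \<le> L" for j
  proof -
    let ?g = "\<lambda>d. if l \<le> s * N j d / W j \<and> (\<forall>k\<in>{j<..L}. \<not> l \<le> s * N k d / W k) then 1 else 0 :: real"
    have "exp l * (\<Sum>d\<in>T j. p d) \<le> (\<Sum>d\<in>T j. p d * X j d)"
      unfolding sum_distrib_left
    proof (rule sum_mono)
      fix d assume "d \<in> T j"
      then have "p d * exp l \<le> p d * X j d"
        by (intro mult_left_mono p0) (auto simp: T_def X_def)
      then show "exp l * p d \<le> p d * X j d" by (simp add: mult.commute)
    qed
    also have "\<dots> = (\<Sum>d\<in>?D. ?g d * (p d * X j d))"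
      unfolding T_def using finD by (auto simp: sum.inter_filter intro!: sum.cong)
    also have "\<dots> \<le> (\<Sum>d\<in>?D. ?g d * (p d * X 0 d))"
    \<comment> \<open>Membership in \<open>T j\<close> is decided by the counts at levels
      \<open>k \<ge> j\<close>, which see \<open>d\<close> only through
      \<open>max (d i) j\<close>.\<close>
    proof (rule step[OF j])
      fix d d' :: "'i \<Rightarrow> nat" assume eq: "\<And>i. i \<in> I \<Longrightarrow> max (d i) j = max (d' i) j"
      have "N k d = N k d'" if "j \<le> k" for k
      proof -
        have "{i \<in> I. d i \<le> k} = {i \<in> I. d' i \<le> k}"
          using eq that by (metis (lifting) max.bounded_iff max.absorb_iff2)
        then show ?thesis by (simp add: N_def)
      qed
      then show "?g d = ?g d'" by simp
    qed auto
    also have "\<dots> = (\<Sum>d\<in>T j. p d * X 0 d)"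
      unfolding T_def using finD by (auto simp: sum.inter_filter intro!: sum.cong)
    finally show ?thesis .
  qed
  let ?H = "{d. d \<in> ?D \<and> (\<exists>j\<le>L. l \<le> s * N j d / W j)}"
  have H: "?H = (\<Union>j\<in>{..L}. T j)"
  proof (intro set_eqI iffI)
    fix d assume "d \<in> ?H"
    then have d: "d \<in> ?D" and ex: "\<exists>j. j \<le> L \<and> l \<le> s * N j d / W j" by auto
    define j where "j = (GREATEST j. j \<le> L \<and> l \<le> s * N j d / W j)"
    have j: "j \<le> L \<and> l \<le> s * N j d / W j"
      unfolding j_def by (rule GreatestI_ex_nat[OF ex]) auto
    have "\<not> l \<le> s * N k d / W k" if "k \<in> {j<..L}" for k
      using Greatest_le_nat[of "\<lambda>j. j \<le> L \<and> l \<le> s * N j d / W j" k L] that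
      unfolding j_def[symmetric] by auto
    with d j show "d \<in> (\<Union>j\<in>{..L}. T j)" by (auto simp: T_def)
  qed (auto simp: T_def)
  have disj: "T i \<inter> T j = {}" if "i \<le> L" "j \<le> L" "i \<noteq> j" for i j
    using that by (fastforce simp: T_def neq_iff)
  have finT: "finite (T j)" for j using finD by (auto simp: T_def)
  have "exp l * (\<Sum>d\<in>?H. p d) = (\<Sum>j\<le>L. exp l * (\<Sum>d\<in>T j. p d))"
    unfolding H sum_distrib_left by (rule sum.UNION_disjoint) (use finT disj in auto)
  also have "\<dots> \<le> (\<Sum>j\<le>L. \<Sum>d\<in>T j. p d * X 0 d)"
    by (intro sum_mono T_step) auto
  also have "\<dots> = (\<Sum>d\<in>?H. p d * X 0 d)"
    unfolding H by (rule sum.UNION_disjoint[symmetric]) (use finT disj in auto)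
  \<comment> \<open>The restriction to \<open>?H\<close> is dropped; by independence the full
    exponential moment at level 0 then factors.\<close>
  also have "\<dots> \<le> (\<Sum>d\<in>?D. p d * X 0 d)"
    by (rule sum_mono2) (use finD p0 in \<open>auto simp: X_def\<close>)
  also have "\<dots> = (\<Sum>d\<in>?D. \<Prod>i\<in>I. w i (d i) * (if d i \<le> 0 then exp (s / W 0) else 1))"
    by (simp add: p_def Xprod prod.distrib)
  also have "\<dots> = (\<Prod>i\<in>I. \<Sum>c\<le>L. w i c * (if c \<le> 0 then exp (s / W 0) else 1))"
    by (rule prod_sum_PiE[symmetric]) (use I in auto)
  also have "\<dots> = (\<Prod>i\<in>I. W L - W 0 + W 0 * exp (s / W 0))"
  proof (rule prod.cong[OF refl])
    fix i assume i: "i \<in> I"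
    show "(\<Sum>c\<le>L. w i c * (if c \<le> 0 then exp (s / W 0) else 1)) = W L - W 0 + W 0 * exp (s / W 0)"
      using W[OF i, of L] W[OF i, of 0] by (simp add: sum.atMost_shift)
  qed
  finally have "exp l * (\<Sum>d\<in>?H. p d) \<le> (W L - W 0 + W 0 * exp (s / W 0)) ^ card I"
    by simp
  then show ?thesis
    by (simp add: N_def p_def exp_minus field_simps)
qed

lemma measure_PiM_PiE:
  assumes "finite I" "\<And>i. i \<in> I \<Longrightarrow> prob_space (M i)" "\<And>i. i \<in> I \<Longrightarrow> A i \<in> sets (M i)"
  shows "measure (PiM I M) (PiE I A) = (\<Prod>i\<in>I. measure (M i) (A i))"
proof -
  \<comment> \<open>Outside \<open>I\<close> the factors are replaced by one-point spaces, so that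
    every index carries a probability measure; \<open>PiM I\<close> does not see the change.\<close>
  let ?M = "\<lambda>i. if i \<in> I then M i else count_space {undefined}"
  interpret M': prob_space "?M i" for i
    using assms(2) by (cases "i \<in> I") (auto intro!: prob_spaceI)
  interpret finite_product_prob_space ?M I
    by unfold_locales (use assms(1) in auto)
  have "measure (PiM I ?M) (PiE I A) = (\<Prod>i\<in>I. measure (?M i) (A i))"
    by (rule finite_measure_PiM_emb) (use assms in auto)
  moreover have "PiM I ?M = PiM I M" by (rule PiM_cong) auto
  ultimately show ?thesis by simp
qed

text \<open>The nested sets cut each factor into cells, which reduces the claim to
  \<open>cell_count_maximal_inequality\<close>. A positive \<open>s\<close> catches counts that are
  too large, a negative \<open>s\<close> counts that are too small.\<close>

lemma PiM_maximal_inequality: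
  fixes M :: "'i \<Rightarrow> 'a measure" and A :: "nat \<Rightarrow> 'a set" and W :: "nat \<Rightarrow> real" and l s :: real
  assumes I: "finite I"
    and M: "\<And>i. i \<in> I \<Longrightarrow> prob_space (M i)"
    and A: "\<And>i j. i \<in> I \<Longrightarrow> A j \<in> sets (M i)"
    and mono: "\<And>j k. j \<le> k \<Longrightarrow> A j \<subseteq> A k"
    and W: "\<And>i j. i \<in> I \<Longrightarrow> j < L \<Longrightarrow> measure (M i) (A j) = W j"
    and W0: "0 < W 0" "\<And>j. j < L \<Longrightarrow> W 0 \<le> W j" and L: "0 < L" "W 0 \<le> 1"
  shows "measure (PiM I M)
      {z \<in> space (PiM I M). \<exists>j<L. l \<le> s * real (card {i \<in> I. z i \<in> A j}) / W j}
    \<le> exp (- l) * (1 - W 0 + W 0 * exp (s / W 0)) ^ card I"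
proof -
  interpret P: prob_space "PiM I M" by (rule prob_space_PiM) (rule M)
  \<comment> \<open>By nestedness, the number of sets missing \<open>y\<close> is the first index
    whose set contains \<open>y\<close>; the value \<open>L\<close> marks the points outside all of
    them.\<close>
  define cell where "cell y = card {j. j < L \<and> y \<notin> A j}" for y
  have cell_L: "cell y \<le> L" for y
    unfolding cell_def using card_mono[of "{..<L}" "{j. j < L \<and> y \<notin> A j}"] by auto
  have cell_iff: "cell y \<le> j \<longleftrightarrow> y \<in> A j" if "j < L" for y j
  proof
    assume "y \<in> A j"
    then have "k < j" if "y \<notin> A k" for k using mono[of j k] that by (cases "k < j") auto
    then have "{k. k < L \<and> y \<notin> A k} \<subseteq> {..<j}" by auto
    from card_mono[OF _ this] show "cell y \<le> j" by (simp add: cell_def)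
  next
    assume c: "cell y \<le> j"
    show "y \<in> A j"
    proof (rule ccontr)
      assume "y \<notin> A j"
      then have "{..j} \<subseteq> {k. k < L \<and> y \<notin> A k}" using mono that by force
      from card_mono[OF _ this] c show False by (simp add: cell_def)
    qed
  qed
  define C where "C i c = {y \<in> space (M i). cell y = c}" for i c
  have Cle: "{y \<in> space (M i). cell y \<le> j} \<in> sets (M i)" if "i \<in> I" for i j
  proof (cases "j < L")
    case True
    then have "{y \<in> space (M i). cell y \<le> j} = A j"
      using cell_iff[OF True] sets.sets_into_space[OF A[OF that]] by auto
    then show ?thesis using A[OF that] by simp
  next
    case False
    then have "{y \<in> space (M i). cell y \<le> j} = space (M i)"
      using False order_trans[OF cell_L] by auto
    then show ?thesis by simp
  qed
  have C: "C i c \<in> sets (M i)" if "i \<in> I" for i c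
  proof (cases c)
    case 0
    then show ?thesis using Cle[OF that, of 0] by (simp add: C_def)
  next
    case (Suc k)
    have "C i c = {y \<in> space (M i). cell y \<le> c} - {y \<in> space (M i). cell y \<le> k}"
      by (auto simp: C_def Suc)
    then show ?thesis using Cle[OF that] by simp
  qed
  define w where "w i c = measure (M i) (C i c)" for i c
  \<comment> \<open>The added level \<open>L\<close> has mass 1, so the cells
    \<open>0, ..., L\<close> exhaust each factor. It is the source of the term
    \<open>1 - W 0\<close> in the bound.\<close>
  define V where "V j = (if j < L then W j else 1)" for j
  have wV: "(\<Sum>c\<le>j. w i c) = V j" if i: "i \<in> I" and j: "j \<le> L" for i j
  proof -
    interpret Mi: prob_space "M i" by (rule M[OF i])
    have "(\<Sum>c\<le>j. w i c) = measure (M i) (\<Union>c\<in>{..j}. C i c)"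
      unfolding w_def
      by (rule Mi.finite_measure_finite_Union[symmetric])
         (use C[OF i] in \<open>auto simp: disjoint_family_on_def C_def\<close>)
    also have "(\<Union>c\<in>{..j}. C i c) = {y \<in> space (M i). cell y \<le> j}"
      by (auto simp: C_def)
    also have "measure (M i) \<dots> = V j"
    proof (cases "j < L")
      case True
      then have "{y \<in> space (M i). cell y \<le> j} = A j"
        using cell_iff[OF True] sets.sets_into_space[OF A[OF i]] by auto
      then show ?thesis using W[OF i True] by (simp add: V_def True)
    next
      case False
      then have "{y \<in> space (M i). cell y \<le> j} = space (M i)"
        using False order_trans[OF cell_L] by auto
      then show ?thesis using False by (simp add: V_def Mi.prob_space)
    qed
    finally show ?thesis .
  qed
  define H where "H = {d. d \<in> PiE I (\<lambda>_. {..L}) \<and> (\<exists>j\<le>L. l \<le> s * real (card {i \<in> I. d i \<le> j}) / V j)}"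
  have finH: "finite H"
    unfolding H_def by (rule finite_subset[of _ "PiE I (\<lambda>_. {..L})"]) (use I in \<open>auto intro!: finite_PiE\<close>)
  have CP: "PiE I (\<lambda>i. C i (d i)) \<in> sets (PiM I M)" for d
    by (rule sets_PiM_I_finite) (use I C in auto)
  have "{z \<in> space (PiM I M). \<exists>j<L. l \<le> s * real (card {i \<in> I. z i \<in> A j}) / W j}
      \<subseteq> (\<Union>d\<in>H. PiE I (\<lambda>i. C i (d i)))"
  proof
    fix z assume "z \<in> {z \<in> space (PiM I M). \<exists>j<L. l \<le> s * real (card {i \<in> I. z i \<in> A j}) / W j}"
    then obtain j where z: "z \<in> space (PiM I M)" and j: "j < L"
      and le: "l \<le> s * real (card {i \<in> I. z i \<in> A j}) / W j" by auto
    define d where "d = restrict (\<lambda>i. cell (z i)) I"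
    have eq: "{i \<in> I. d i \<le> j} = {i \<in> I. z i \<in> A j}"
      using cell_iff[OF j] by (auto simp: d_def)
    have "l \<le> s * real (card {i \<in> I. d i \<le> j}) / V j"
      unfolding eq using le j by (simp add: V_def)
    moreover have "d \<in> PiE I (\<lambda>_. {..L})" using cell_L by (auto simp: d_def)
    ultimately have "d \<in> H" using j less_imp_le unfolding H_def by blast
    moreover have "z \<in> PiE I (\<lambda>i. C i (d i))"
      using z by (auto simp: space_PiM PiE_iff C_def d_def)
    ultimately show "z \<in> (\<Union>d\<in>H. PiE I (\<lambda>i. C i (d i)))" by auto
  qed
  then have "measure (PiM I M)
      {z \<in> space (PiM I M). \<exists>j<L. l \<le> s * real (card {i \<in> I. z i \<in> A j}) / W j}
     \<le> measure (PiM I M) (\<Union>d\<in>H. PiE I (\<lambda>i. C i (d i)))"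
    by (rule P.finite_measure_mono) (use finH CP in auto)
  also have "\<dots> \<le> (\<Sum>d\<in>H. measure (PiM I M) (PiE I (\<lambda>i. C i (d i))))"
    by (rule P.finite_measure_subadditive_finite) (use finH CP in auto)
  also have "\<dots> = (\<Sum>d\<in>H. \<Prod>i\<in>I. w i (d i))"
    unfolding w_def by (intro sum.cong refl measure_PiM_PiE I M C)
  also have "\<dots> \<le> exp (- l) * (V L - V 0 + V 0 * exp (s / V 0)) ^ card I"
    unfolding H_def
    by (rule cell_count_maximal_inequality) (use I wV W0 L in \<open>auto simp: V_def w_def\<close>)
  finally show ?thesis using L by (simp add: V_def)
qed

section \<open>Linear boundaries on one block under the null hypothesis\<close>

lemma measure_uniform_law_atMost:
  assumes "0 \<le> u" "u \<le> 1"
  shows "measure (uniform_law 1) {..u} = u"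
proof -
  have "{0..1} \<inter> {..u} = {0..u}" using assms by auto
  then show ?thesis unfolding uniform_law_def
    using assms by (subst measure_uniform_measure) auto
qed

lemma measure_uniform_law_greaterThan:
  assumes "0 \<le> u" "u \<le> a" "0 < a"
  shows "measure (uniform_law a) {u<..} = 1 - u / a"
proof -
  have "{0..a} \<inter> {u<..} = {u<..a}" using assms by auto
  then show ?thesis unfolding uniform_law_def
    using assms by (subst measure_uniform_measure) (auto simp: field_simps)
qed

lemma sets_H0_law [measurable_cong]: "sets (H0_law m) = sets (PiM {1..m} (\<lambda>_. borel))"
  unfolding H0_law_def by (intro sets_PiM_cong) auto

lemma prob_space_H0_law: "prob_space (H0_law m)"
  unfolding H0_law_def by (intro prob_space_PiM prob_space_uniform_law) auto

lemma power_one_plus_le_exp: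
  fixes x :: real
  assumes "0 \<le> 1 + x"
  shows "(1 + x) ^ n \<le> exp (real n * x)"
  using power_mono[OF exp_ge_add_one_self assms, of n] by (simp add: exp_of_nat_mult)

lemma grid_ceiling:
  fixes a h u :: real
  assumes "0 < h" "a < u" "u \<le> a + real K * h"
  obtains j where "j < K" "a + real j * h < u" "u \<le> a + real (Suc j) * h"
proof -
  define n where "n = nat \<lceil>(u - a) / h\<rceil>"
  have pos: "0 < (u - a) / h" using assms by simp
  then have "0 < \<lceil>(u - a) / h\<rceil>" by linarith
  then have n: "real n = of_int \<lceil>(u - a) / h\<rceil>" "0 < n" by (auto simp: n_def)
  then obtain j where j: "n = Suc j" by (auto simp: gr0_conv_Suc)
  have "real n - 1 < (u - a) / h" "(u - a) / h \<le> real n" unfolding n by linarith+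
  then have b: "(real n - 1) * h < u - a" "u - a \<le> real n * h"
    using assms by (simp_all add: field_simps)
  have "(u - a) / h \<le> real K" using assms by (simp add: field_simps)
  then have "n \<le> K" unfolding n_def by (simp add: ceiling_le_iff nat_le_iff)
  then show ?thesis using b that[of j] by (simp add: j)
qed

lemma small_mesh:
  fixes x y :: real
  assumes "0 < y"
  obtains K :: nat where "0 < K" "x / real K \<le> y"
proof -
  obtain n :: nat where "x / y < real n" using reals_Archimedean2 by blast
  then have "x / real (Suc n) \<le> y" using assms by (simp add: field_simps)
  then show ?thesis using that[of "Suc n"] by blast
qed

text \<open>The factor 2 pays for replacing the continuum of levels by a finite grid.\<close>

lemma upper_block:
  fixes a b c r :: real
  assumes ab: "0 < a" "a < b" "b \<le> 1" and r: "0 \<le> r"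
  shows "measure (H0_law m) {z \<in> space (H0_law m).
      \<exists>i\<in>{1..m}. a \<le> z i \<and> z i \<le> b \<and> c * z i \<le> real (card {j \<in> {1..m}. z j \<le> z i})}
    \<le> 2 * exp (real m * a * (exp r - 1) - r * a * c)"
proof -
  interpret P: prob_space "H0_law m" by (rule prob_space_H0_law)
  \<comment> \<open>The mesh is so fine that rounding to the grid costs at most a factor
    \<open>exp (ln 2)\<close>.\<close>
  obtain K :: nat where K: "0 < K" "r * \<bar>c\<bar> * (b - a) / real K \<le> ln 2"
    using small_mesh[of "ln 2"] by auto
  define h where "h = (b - a) / real K"
  have h: "0 < h" "a + real K * h = b" using ab K by (auto simp: h_def)
  \<comment> \<open>The grid is frozen at \<open>b\<close> from index \<open>K\<close> on, so every
    level lies in \<open>[a, b]\<close>.\<close>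
  define u where "u j = a + real (min j K) * h" for j
  have u0: "u 0 = a" by (simp add: u_def)
  have u_le: "u j \<le> b" for j
  proof -
    have "real (min j K) * h \<le> real K * h" using h by (intro mult_right_mono) auto
    then show ?thesis unfolding u_def using h by linarith
  qed
  have u_ge: "a \<le> u j" for j using h by (simp add: u_def)
  have u_mono: "u j \<le> u k" if "j \<le> k" for j k
    using that h by (auto simp: u_def intro!: mult_right_mono)
  let ?N = "\<lambda>z v. real (card {j \<in> {1..m}. z j \<le> v})"
  \<comment> \<open>\<open>?s\<close> is scaled so that \<open>?s / u 0 = r\<close> at the bottom
    level. \<open>?l\<close> is the exponent for slope \<open>c\<close>, reduced by the cost of
    moving \<open>z i\<close> up by at most \<open>h\<close>.\<close>
  let ?s = "r * a" and ?l = "r * a * c - r * \<bar>c\<bar> * h"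
  let ?G = "{z \<in> space (H0_law m). \<exists>j<Suc K. ?l \<le> ?s * real (card {i \<in> {1..m}. z i \<in> {..u j}}) / u j}"
  have "{z \<in> space (H0_law m). \<exists>i\<in>{1..m}. a \<le> z i \<and> z i \<le> b \<and> c * z i \<le> ?N z (z i)} \<subseteq> ?G"
  proof (safe, goal_cases)
    case (1 z i)
    obtain j where j: "j \<le> K" "z i \<le> u j" "u j \<le> z i + h"
    proof (cases "z i = a")
      case True
      then show ?thesis using that[of 0] u0 h by auto
    next
      case False
      then have "a < z i" "z i \<le> a + real K * h" using 1 h by auto
      from grid_ceiling[OF h(1) this] obtain j where "j < K" "a + real j * h < z i" "z i \<le> a + real (Suc j) * h" .
      then show ?thesis using that[of "Suc j"] by (auto simp: u_def algebra_simps)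
    qed
    have up: "0 < u j" using u_ge[of j] ab by linarith
    have "c * u j - \<bar>c\<bar> * h \<le> c * z i"
    proof -
      have "c * (u j - z i) \<le> \<bar>c\<bar> * (u j - z i)" using j by (intro mult_right_mono) auto
      also have "\<dots> \<le> \<bar>c\<bar> * h" using j by (intro mult_left_mono) auto
      finally show ?thesis by (simp add: algebra_simps)
    qed
    also have "\<dots> \<le> ?N z (u j)"
    proof -
      have "{j \<in> {1..m}. z j \<le> z i} \<subseteq> {i \<in> {1..m}. z i \<le> u j}" using j(2) by auto
      then have "?N z (z i) \<le> ?N z (u j)" by (intro of_nat_mono card_mono) auto
      then show ?thesis using 1 by simp
    qed
    finally have "a * r * (c * u j - \<bar>c\<bar> * h) \<le> a * r * ?N z (u j)"
      using ab r by (intro mult_left_mono) auto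
    moreover have "r * \<bar>c\<bar> * h * a \<le> r * \<bar>c\<bar> * h * u j"
      using u_ge r h by (intro mult_left_mono) auto
    ultimately have "?l * u j \<le> ?s * ?N z (u j)" by (simp add: algebra_simps)
    then have "?l \<le> ?s * ?N z (u j) / u j" using up by (simp add: pos_le_divide_eq)
    then show ?case using j(1) by (auto intro!: exI[of _ j])
  qed
  moreover have "?G \<in> sets (H0_law m)"
  proof -
    have "real (card {i \<in> {1..m}. z i \<in> {..u j}}) = (\<Sum>i\<in>{1..m}. if z i \<le> u j then 1 else 0)" for z :: "nat \<Rightarrow> real" and j
      by (simp add: sum.If_cases Int_def)
    then show ?thesis by simp measurable
  qed
  ultimately have "measure (H0_law m) {z \<in> space (H0_law m).
      \<exists>i\<in>{1..m}. a \<le> z i \<and> z i \<le> b \<and> c * z i \<le> ?N z (z i)} \<le> measure (H0_law m) ?G"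
    by (rule P.finite_measure_mono)
  also have "\<dots> \<le> exp (- ?l) * (1 - u 0 + u 0 * exp (?s / u 0)) ^ card {1..m}"
    unfolding H0_law_def
  proof (rule PiM_maximal_inequality)
    fix j assume "j < Suc K"
    have "0 \<le> u j" "u j \<le> 1" using u_le[of j] u_ge[of j] ab by linarith+
    then show "measure (uniform_law 1) {..u j} = u j" by (rule measure_uniform_law_atMost)
  qed (use u0 u_ge u_le u_mono ab in \<open>auto intro!: prob_space_uniform_law\<close>)
  also have "\<dots> = exp (- ?l) * (1 + a * (exp r - 1)) ^ m"
    using ab by (simp add: u0 algebra_simps)
  also have "\<dots> \<le> exp (- ?l) * exp (real m * (a * (exp r - 1)))"
    using ab r by (intro mult_left_mono power_one_plus_le_exp) (auto intro!: add_nonneg_nonneg mult_nonneg_nonneg)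
  also have "\<dots> = exp (r * \<bar>c\<bar> * h) * exp (real m * a * (exp r - 1) - r * a * c)"
    by (simp add: exp_add[symmetric] algebra_simps)
  also have "\<dots> \<le> 2 * exp (real m * a * (exp r - 1) - r * a * c)"
  proof (intro mult_right_mono)
    have "r * \<bar>c\<bar> * h \<le> ln 2" using K by (simp add: h_def)
    then have "exp (r * \<bar>c\<bar> * h) \<le> exp (ln 2)" by (subst exp_le_cancel_iff)
    then show "exp (r * \<bar>c\<bar> * h) \<le> 2" by simp
  qed auto
  finally show ?thesis .
qed

text \<open>Mirror image of \<open>upper_block\<close>: the sets \<open>{1 - u j<..}\<close> grow
  with \<open>u j\<close> and have null probability \<open>u j\<close>, and a negative parameter in
  the maximal inequality detects small counts. Here \<open>1 - z i\<close> is rounded down to the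
  grid, which can only decrease the count of points above.\<close>

lemma lower_block:
  fixes a b c r :: real
  assumes ab: "0 < a" "a < b" "b \<le> 1" and r: "0 \<le> r"
  shows "measure (H0_law m) {z \<in> space (H0_law m).
      \<exists>i\<in>{1..m}. a < 1 - z i \<and> 1 - z i \<le> b \<and> real (card {j \<in> {1..m}. z i < z j}) \<le> c * (1 - z i)}
    \<le> 2 * exp (real m * a * (exp (- r) - 1) + r * a * c)"
proof -
  interpret P: prob_space "H0_law m" by (rule prob_space_H0_law)
  obtain K :: nat where K: "0 < K" "r * \<bar>c\<bar> * (b - a) / real K \<le> ln 2"
    using small_mesh[of "ln 2"] by auto
  define h where "h = (b - a) / real K"
  have h: "0 < h" "a + real K * h = b" using ab K by (auto simp: h_def)
  define u where "u j = a + real (min j K) * h" for j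
  have u0: "u 0 = a" by (simp add: u_def)
  have u_le: "u j \<le> b" for j
  proof -
    have "real (min j K) * h \<le> real K * h" using h by (intro mult_right_mono) auto
    then show ?thesis unfolding u_def using h by linarith
  qed
  have u_ge: "a \<le> u j" for j using h by (simp add: u_def)
  have u_mono: "u j \<le> u k" if "j \<le> k" for j k
    using that h by (auto simp: u_def intro!: mult_right_mono)
  let ?N = "\<lambda>z v. real (card {j \<in> {1..m}. v < z j})"
  let ?s = "- (r * a)" and ?l = "- (r * a * c + r * \<bar>c\<bar> * h)"
  let ?G = "{z \<in> space (H0_law m). \<exists>j<Suc K. ?l \<le> ?s * real (card {i \<in> {1..m}. z i \<in> {1 - u j<..}}) / u j}"
  have "{z \<in> space (H0_law m). \<exists>i\<in>{1..m}. a < 1 - z i \<and> 1 - z i \<le> b \<and> ?N z (z i) \<le> c * (1 - z i)} \<subseteq> ?G"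
  proof (safe, goal_cases)
    case (1 z i)
    then have "a < 1 - z i" "1 - z i \<le> a + real K * h" using h by auto
    from grid_ceiling[OF h(1) this] obtain j where
      "j < K" "a + real j * h < 1 - z i" "1 - z i \<le> a + real (Suc j) * h" .
    then have j: "j \<le> K" "u j < 1 - z i" "1 - z i \<le> u j + h" by (auto simp: u_def algebra_simps)
    have up: "0 < u j" using u_ge[of j] ab by linarith
    have "{i \<in> {1..m}. 1 - u j < z i} \<subseteq> {j \<in> {1..m}. z i < z j}" using j(2) by auto
    then have "?N z (1 - u j) \<le> ?N z (z i)" by (intro of_nat_mono card_mono) auto
    also have "\<dots> \<le> c * (1 - z i)" using 1 by simp
    also have "\<dots> \<le> c * u j + \<bar>c\<bar> * h"
    proof -
      have "c * (1 - z i - u j) \<le> \<bar>c\<bar> * (1 - z i - u j)" using j by (intro mult_right_mono) auto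
      also have "\<dots> \<le> \<bar>c\<bar> * h" using j by (intro mult_left_mono) auto
      finally show ?thesis by (simp add: algebra_simps)
    qed
    finally have "a * r * ?N z (1 - u j) \<le> a * r * (c * u j + \<bar>c\<bar> * h)"
      using ab r by (intro mult_left_mono) auto
    moreover have "r * \<bar>c\<bar> * h * a \<le> r * \<bar>c\<bar> * h * u j"
      using u_ge r h by (intro mult_left_mono) auto
    ultimately have "?l * u j \<le> ?s * ?N z (1 - u j)" by (simp add: algebra_simps)
    then have "?l \<le> ?s * ?N z (1 - u j) / u j" using up by (subst pos_le_divide_eq)
    then show ?case using j(1) by (auto intro!: exI[of _ j])
  qed
  moreover have "?G \<in> sets (H0_law m)"
  proof -
    have "real (card {i \<in> {1..m}. z i \<in> {1 - u j<..}}) = (\<Sum>i\<in>{1..m}. if 1 - u j < z i then 1 else 0)" for z :: "nat \<Rightarrow> real" and j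
      by (simp add: sum.If_cases Int_def)
    then show ?thesis by simp measurable
  qed
  ultimately have "measure (H0_law m) {z \<in> space (H0_law m).
      \<exists>i\<in>{1..m}. a < 1 - z i \<and> 1 - z i \<le> b \<and> ?N z (z i) \<le> c * (1 - z i)} \<le> measure (H0_law m) ?G"
    by (rule P.finite_measure_mono)
  also have "\<dots> \<le> exp (- ?l) * (1 - u 0 + u 0 * exp (?s / u 0)) ^ card {1..m}"
    unfolding H0_law_def
  proof (rule PiM_maximal_inequality)
    fix j assume "j < Suc K"
    have "0 \<le> 1 - u j" "1 - u j \<le> 1" using u_le[of j] u_ge[of j] ab by linarith+
    from measure_uniform_law_greaterThan[OF this] show "measure (uniform_law 1) {1 - u j<..} = u j" by simp
  qed (use u0 u_ge u_le u_mono ab in \<open>auto intro!: prob_space_uniform_law dest: u_mono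
          intro: order_trans le_less_trans\<close>)
  also have "\<dots> = exp (- ?l) * (1 + a * (exp (- r) - 1)) ^ m"
    using ab by (simp add: u0 algebra_simps)
  also have "\<dots> \<le> exp (- ?l) * exp (real m * (a * (exp (- r) - 1)))"
  proof (intro mult_left_mono power_one_plus_le_exp)
    have "a * (1 - exp (- r)) \<le> 1 * 1" using ab r by (intro mult_mono) auto
    then show "0 \<le> 1 + a * (exp (- r) - 1)" by (simp add: algebra_simps)
  qed auto
  also have "\<dots> = exp (r * \<bar>c\<bar> * h) * exp (real m * a * (exp (- r) - 1) + r * a * c)"
    by (simp add: exp_add[symmetric] algebra_simps)
  also have "\<dots> \<le> 2 * exp (real m * a * (exp (- r) - 1) + r * a * c)"
  proof (intro mult_right_mono)
    have "r * \<bar>c\<bar> * h \<le> ln 2" using K by (simp add: h_def)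
    then have "exp (r * \<bar>c\<bar> * h) \<le> exp (ln 2)" by (subst exp_le_cancel_iff)
    then show "exp (r * \<bar>c\<bar> * h) \<le> 2" by simp
  qed auto
  finally show ?thesis .
qed

text \<open>\<open>HC \<ge> x\<close> at the observation \<open>z i\<close>, with denominators cleared.\<close>

definition exceeds :: "nat \<Rightarrow> real \<Rightarrow> (nat \<Rightarrow> real) \<Rightarrow> nat \<Rightarrow> bool" where
  "exceeds m x z i \<longleftrightarrow> real m * z i + x * sqrt (real m * z i * (1 - z i))
     \<le> real (card {j \<in> {1..m}. z j \<le> z i})"

section \<open>The curved boundary of \<open>exceeds\<close> on one block\<close>

lemma borel_measurable_H0_component:
  assumes "j \<in> {1..m}"
  shows "(\<lambda>z. z j) \<in> borel_measurable (H0_law m)"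
  using assms by measurable

lemma borel_measurable_H0_card:
  assumes i: "i \<in> {1..m}"
  shows "(\<lambda>z. real (card {j \<in> {1..m}. z j \<le> z i})) \<in> borel_measurable (H0_law m)"
proof -
  have "real (card {j \<in> {1..m}. z j \<le> z i}) = (\<Sum>j\<in>{1..m}. if z j \<le> z i then 1 else 0)" for z :: "nat \<Rightarrow> real"
    by (simp add: sum.If_cases Int_def)
  moreover have "(\<lambda>z. \<Sum>j\<in>{1..m}. if z j \<le> z i then 1 else 0 :: real) \<in> borel_measurable (H0_law m)"
    by (intro borel_measurable_sum measurable_If borel_measurable_const borel_measurable_le
        borel_measurable_H0_component i)
  ultimately show ?thesis by simp
qed

lemma sets_H0_exceeds:
  assumes "i \<in> {1..m}"
  shows "{z \<in> space (H0_law m). exceeds m x z i} \<in> sets (H0_law m)"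
proof -
  have [measurable]: "(\<lambda>z. z i) \<in> borel_measurable (H0_law m)"
    using assms by (rule borel_measurable_H0_component)
  have "(\<lambda>z. real m * z i + x * sqrt (real m * z i * (1 - z i))) \<in> borel_measurable (H0_law m)"
    by measurable
  then show ?thesis unfolding exceeds_def
    using assms by (intro borel_measurable_le borel_measurable_H0_card)
qed

lemma sets_H0_bex:
  assumes "\<And>i. i \<in> {1..m} \<Longrightarrow> {z \<in> space (H0_law m). P i z} \<in> sets (H0_law m)"
  shows "{z \<in> space (H0_law m). \<exists>i\<in>{1..m}. P i z} \<in> sets (H0_law m)"
  by (rule sets.sets_Collect_finite_Ex) (use assms in auto)

lemmas sets_H0_intros = sets_H0_bex sets.sets_Collect_conj borel_measurable_le borel_measurable_less
  borel_measurable_times borel_measurable_diff borel_measurable_const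
  borel_measurable_H0_card borel_measurable_H0_component sets_H0_exceeds

lemma mult_sqrt_eq_sqrt:
  fixes u t :: real
  assumes "0 \<le> u"
  shows "u * sqrt t = sqrt (u\<^sup>2 * t)"
  using assms by (simp only: real_sqrt_mult) simp

text \<open>On \<open>(a, \<theta> * a]\<close> the square-root boundary lies above a line through
  the origin, and \<open>upper_block\<close> applies to that line. The price is the factor
  \<open>sqrt ((1 - B) / \<theta>)\<close> on \<open>x\<close>, close to 1 when
  \<open>\<theta>\<close> is close to 1 and \<open>B\<close> is small.\<close>

lemma upper_block_exceeds:
  fixes a B x r \<theta> :: real
  assumes "0 < a" "1 < \<theta>" "\<theta> * a \<le> B" "B < 1" "0 \<le> r" "0 \<le> x"
  shows "measure (H0_law m) {z \<in> space (H0_law m).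
      \<exists>i\<in>{1..m}. a < z i \<and> z i \<le> \<theta> * a \<and> exceeds m x z i}
    \<le> 2 * exp (real m * a * (exp r - 1 - r) - r * (x * sqrt ((1 - B) / \<theta>)) * sqrt (real m * a))"
proof -
  interpret P: prob_space "H0_law m" by (rule prob_space_H0_law)
  \<comment> \<open>This slope comes from \<open>u \<le> \<theta> * a\<close> and
    \<open>1 - u \<ge> 1 - B\<close>: together they give
    \<open>u * sqrt ((1 - B) / (\<theta> * a)) \<le> sqrt (u * (1 - u))\<close>.\<close>
  define c where "c = real m + x * sqrt (real m * (1 - B) / (\<theta> * a))"
  have "a < \<theta> * a" using assms by simp
  have le: "c * u \<le> real m * u + x * sqrt (real m * u * (1 - u))" if "a < u" "u \<le> \<theta> * a" for u
  proof -
    have "u * sqrt (real m * (1 - B) / (\<theta> * a)) = sqrt (u\<^sup>2 * (real m * (1 - B) / (\<theta> * a)))"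
      using that assms by (intro mult_sqrt_eq_sqrt) auto
    also have "\<dots> \<le> sqrt (real m * u * (1 - u))"
    proof -
      have "u * (1 - B) \<le> (1 - u) * (\<theta> * a)"
        using mult_mono[of u "\<theta> * a" "1 - B" "1 - u"] that assms by (simp add: mult.commute)
      then have "u * (u * (1 - B)) * real m \<le> u * ((1 - u) * (\<theta> * a)) * real m"
        using that assms by (intro mult_left_mono mult_right_mono) auto
      then have "u\<^sup>2 * (real m * (1 - B)) \<le> real m * u * (1 - u) * (\<theta> * a)"
        by (simp add: power2_eq_square mult_ac)
      then show ?thesis using assms by (simp add: pos_divide_le_eq)
    qed
    finally have "x * (u * sqrt (real m * (1 - B) / (\<theta> * a))) \<le> x * sqrt (real m * u * (1 - u))"
      using assms by (intro mult_left_mono)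
    then show ?thesis by (simp add: c_def algebra_simps)
  qed
  have "measure (H0_law m) {z \<in> space (H0_law m).
      \<exists>i\<in>{1..m}. a < z i \<and> z i \<le> \<theta> * a \<and> exceeds m x z i}
    \<le> measure (H0_law m) {z \<in> space (H0_law m). \<exists>i\<in>{1..m}. a \<le> z i \<and> z i \<le> \<theta> * a
        \<and> c * z i \<le> real (card {j \<in> {1..m}. z j \<le> z i})}"
  proof (rule P.finite_measure_mono)
    show "{z \<in> space (H0_law m). \<exists>i\<in>{1..m}. a \<le> z i \<and> z i \<le> \<theta> * a
        \<and> c * z i \<le> real (card {j \<in> {1..m}. z j \<le> z i})} \<in> sets (H0_law m)"
      by (intro sets_H0_intros)
  qed (use le in \<open>force simp: exceeds_def\<close>)
  also have "\<dots> \<le> 2 * exp (real m * a * (exp r - 1) - r * a * c)"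
    by (rule upper_block) (use assms \<open>a < \<theta> * a\<close> in auto)
  also have "real m * a * (exp r - 1) - r * a * c =
      real m * a * (exp r - 1 - r) - r * (x * sqrt ((1 - B) / \<theta>)) * sqrt (real m * a)"
  proof -
    have "a * sqrt (real m * (1 - B) / (\<theta> * a)) = sqrt (a\<^sup>2 * (real m * (1 - B) / (\<theta> * a)))"
      using assms by (intro mult_sqrt_eq_sqrt) auto
    also have "a\<^sup>2 * (real m * (1 - B) / (\<theta> * a)) = (1 - B) / \<theta> * (real m * a)"
      using assms by (simp add: power2_eq_square field_simps)
    finally have "a * sqrt (real m * (1 - B) / (\<theta> * a)) = sqrt ((1 - B) / \<theta>) * sqrt (real m * a)"
      by (simp only: real_sqrt_mult)
    moreover have "r * a * c = real m * a * r + r * x * (a * sqrt (real m * (1 - B) / (\<theta> * a)))"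
      by (simp add: c_def algebra_simps)
    ultimately show ?thesis by (simp add: algebra_simps)
  qed
  finally show ?thesis .
qed

text \<open>The product of \<open>1 - r + r\<^sup>2 / 2\<close> with the Taylor polynomial
  \<open>1 + r + r\<^sup>2 / 2 \<le> exp r\<close> is \<open>1 + r ^ 4 / 4\<close>, hence at least
  1.\<close>

lemma exp_minus_le_quadratic:
  fixes r :: real
  assumes "0 \<le> r"
  shows "exp (- r) \<le> 1 - r + r\<^sup>2 / 2"
proof -
  have 1: "1 + r + r\<^sup>2 / 2 \<le> exp r" using exp_lower_Taylor_quadratic[OF assms] .
  have "0 \<le> (r - 1)\<^sup>2" by simp
  then have pos: "0 \<le> 1 - r + r\<^sup>2 / 2" by (simp add: power2_eq_square algebra_simps)
  have "1 \<le> (1 - r + r\<^sup>2 / 2) * (1 + r + r\<^sup>2 / 2)"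
  proof -
    have "(1 - r + r\<^sup>2 / 2) * (1 + r + r\<^sup>2 / 2) = 1 + (r\<^sup>2)\<^sup>2 / 4"
      by (simp add: power2_eq_square algebra_simps)
    then show ?thesis by simp
  qed
  also have "\<dots> \<le> (1 - r + r\<^sup>2 / 2) * exp r"
    using 1 pos by (rule mult_left_mono)
  finally show ?thesis by (simp add: exp_minus field_simps)
qed

lemma card_le_plus_card_greater:
  fixes z :: "nat \<Rightarrow> real"
  shows "card {i \<in> {1..m}. z i \<le> u} + card {i \<in> {1..m}. u < z i} = m"
proof -
  have "card {i \<in> {1..m}. z i \<le> u} + card {i \<in> {1..m}. u < z i}
      = card ({i \<in> {1..m}. z i \<le> u} \<union> {i \<in> {1..m}. u < z i})"
    by (intro card_Un_disjoint[symmetric]) auto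
  also have "{i \<in> {1..m}. z i \<le> u} \<union> {i \<in> {1..m}. u < z i} = {1..m}" by auto
  finally show ?thesis by simp
qed

text \<open>Too many points up to \<open>z i\<close> means too few points above it. For such
  deficits \<open>exp_minus_le_quadratic\<close> bounds the moment generating function by a Gaussian
  one for all \<open>r \<ge> 0\<close>, so the exponent is Gaussian uniformly in
  \<open>a\<close>.\<close>

lemma lower_block_exceeds:
  fixes a B x \<theta> :: real
  assumes "0 < a" "1 < \<theta>" "\<theta> * a \<le> B" "B < 1" "0 \<le> x" "0 < m"
  shows "measure (H0_law m) {z \<in> space (H0_law m).
      \<exists>i\<in>{1..m}. a < 1 - z i \<and> 1 - z i \<le> \<theta> * a \<and> exceeds m x z i}
    \<le> 2 * exp (- ((1 - B) / \<theta> * x\<^sup>2 / 2))"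
proof -
  interpret P: prob_space "H0_law m" by (rule prob_space_H0_law)
  define c where "c = real m - x * sqrt (real m * (1 - B) / (\<theta> * a))"
  define y where "y = x * sqrt ((1 - B) / \<theta>)"
  \<comment> \<open>The minimiser of
    \<open>real m * a * r\<^sup>2 / 2 - r * y * sqrt (real m * a)\<close>, with minimum
    \<open>- (y\<^sup>2 / 2)\<close>.\<close>
  define r where "r = y / sqrt (real m * a)"
  have y: "0 \<le> y" "y\<^sup>2 = (1 - B) / \<theta> * x\<^sup>2"
    using assms by (auto simp: y_def power_mult_distrib)
  have r: "0 \<le> r" using y assms by (simp add: r_def)
  have "a < \<theta> * a" using assms by simp
  have le: "real m * v - x * sqrt (real m * (1 - v) * v) \<le> c * v" if "a < v" "v \<le> \<theta> * a" for v
  proof -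
    have "v * sqrt (real m * (1 - B) / (\<theta> * a)) = sqrt (v\<^sup>2 * (real m * (1 - B) / (\<theta> * a)))"
      using that assms by (intro mult_sqrt_eq_sqrt) auto
    also have "\<dots> \<le> sqrt (real m * (1 - v) * v)"
    proof -
      have "v * (1 - B) \<le> (1 - v) * (\<theta> * a)"
        using mult_mono[of v "\<theta> * a" "1 - B" "1 - v"] that assms by (simp add: mult.commute)
      then have "v * (v * (1 - B)) * real m \<le> v * ((1 - v) * (\<theta> * a)) * real m"
        using that assms by (intro mult_left_mono mult_right_mono) auto
      then have "v\<^sup>2 * (real m * (1 - B)) \<le> real m * (1 - v) * v * (\<theta> * a)"
        by (simp add: power2_eq_square mult_ac)
      then show ?thesis using assms by (simp add: pos_divide_le_eq)
    qed
    finally have "x * (v * sqrt (real m * (1 - B) / (\<theta> * a))) \<le> x * sqrt (real m * (1 - v) * v)"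
      using assms by (intro mult_left_mono)
    then show ?thesis by (simp add: c_def algebra_simps)
  qed
  have card_gt: "real (card {j \<in> {1..m}. z i < z j}) = real m - real (card {j \<in> {1..m}. z j \<le> z i})"
    for z :: "nat \<Rightarrow> real" and i
    using card_le_plus_card_greater[of m z "z i"] by linarith
  have "measure (H0_law m) {z \<in> space (H0_law m).
      \<exists>i\<in>{1..m}. a < 1 - z i \<and> 1 - z i \<le> \<theta> * a \<and> exceeds m x z i}
    \<le> measure (H0_law m) {z \<in> space (H0_law m). \<exists>i\<in>{1..m}. a < 1 - z i \<and> 1 - z i \<le> \<theta> * a
        \<and> real (card {j \<in> {1..m}. z i < z j}) \<le> c * (1 - z i)}"
  proof (rule P.finite_measure_mono)
    show "{z \<in> space (H0_law m). \<exists>i\<in>{1..m}. a < 1 - z i \<and> 1 - z i \<le> \<theta> * a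
        \<and> real (card {j \<in> {1..m}. z i < z j}) \<le> c * (1 - z i)} \<in> sets (H0_law m)"
      unfolding card_gt by (intro sets_H0_intros)
    show "{z \<in> space (H0_law m). \<exists>i\<in>{1..m}. a < 1 - z i \<and> 1 - z i \<le> \<theta> * a \<and> exceeds m x z i}
      \<subseteq> {z \<in> space (H0_law m). \<exists>i\<in>{1..m}. a < 1 - z i \<and> 1 - z i \<le> \<theta> * a
        \<and> real (card {j \<in> {1..m}. z i < z j}) \<le> c * (1 - z i)}"
    proof safe
      fix z i assume z: "i \<in> {1..m}" "a < 1 - z i" "1 - z i \<le> \<theta> * a" "exceeds m x z i"
      have "real (card {j \<in> {1..m}. z i < z j}) \<le> c * (1 - z i)"
        using le[OF z(2,3)] z(4) unfolding exceeds_def card_gt by (simp add: algebra_simps)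
      with z show "\<exists>i\<in>{1..m}. a < 1 - z i \<and> 1 - z i \<le> \<theta> * a
        \<and> real (card {j \<in> {1..m}. z i < z j}) \<le> c * (1 - z i)" by blast
    qed
  qed
  also have "\<dots> \<le> 2 * exp (real m * a * (exp (- r) - 1) + r * a * c)"
    by (rule lower_block) (use assms r \<open>a < \<theta> * a\<close> in auto)
  also have "\<dots> \<le> 2 * exp (- ((1 - B) / \<theta> * x\<^sup>2 / 2))"
  proof -
    have "a * sqrt (real m * (1 - B) / (\<theta> * a)) = sqrt (a\<^sup>2 * (real m * (1 - B) / (\<theta> * a)))"
      using assms by (intro mult_sqrt_eq_sqrt) auto
    also have "a\<^sup>2 * (real m * (1 - B) / (\<theta> * a)) = (1 - B) / \<theta> * (real m * a)"
      using assms by (simp add: power2_eq_square field_simps)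
    finally have "a * sqrt (real m * (1 - B) / (\<theta> * a)) = sqrt ((1 - B) / \<theta>) * sqrt (real m * a)"
      by (simp only: real_sqrt_mult)
    moreover have "r * a * c = real m * a * r - r * x * (a * sqrt (real m * (1 - B) / (\<theta> * a)))"
      by (simp add: c_def algebra_simps)
    ultimately have "r * a * c = real m * a * r - r * y * sqrt (real m * a)"
      by (simp add: y_def algebra_simps)
    also have "r * y * sqrt (real m * a) = y\<^sup>2"
      using assms by (simp add: r_def power2_eq_square)
    finally have eq: "r * a * c = real m * a * r - y\<^sup>2" .
    have "real m * a * r\<^sup>2 = y\<^sup>2"
      using assms by (simp add: r_def power_divide)
    moreover have "real m * a * (exp (- r) - 1) \<le> real m * a * (- r + r\<^sup>2 / 2)"
      using exp_minus_le_quadratic[OF r] assms by (intro mult_left_mono) auto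
    ultimately have "real m * a * (exp (- r) - 1) + r * a * c \<le> - (y\<^sup>2 / 2)"
      unfolding eq by (simp add: algebra_simps)
    then show ?thesis by (simp add: y(2))
  qed
  finally show ?thesis .
qed

section \<open>Geometric covers and exponential rates\<close>

text \<open>Union bound over the blocks from \<open>\<alpha> * \<theta> ^ k\<close> to
  \<open>\<alpha> * \<theta> ^ (k + 1)\<close>. Their number is the logarithm of
  \<open>\<beta> / \<alpha>\<close> to base \<open>\<theta>\<close>, rounded up.\<close>

lemma (in prob_space) prob_geometric_cover:
  fixes \<alpha> \<beta> \<theta> D :: real and g :: "'i \<Rightarrow> 'a \<Rightarrow> real"
  assumes ab: "0 < \<alpha>" "\<alpha> \<le> \<beta>" "1 < \<theta>"
    and meas: "\<And>a. {z \<in> space M. \<exists>i\<in>I. a < g i z \<and> g i z \<le> \<theta> * a \<and> Q i z} \<in> events"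
    and block: "\<And>a. \<alpha> \<le> a \<Longrightarrow> a \<le> \<beta> \<Longrightarrow>
      prob {z \<in> space M. \<exists>i\<in>I. a < g i z \<and> g i z \<le> \<theta> * a \<and> Q i z} \<le> D"
  shows "prob {z \<in> space M. \<exists>i\<in>I. \<alpha> < g i z \<and> g i z \<le> \<beta> \<and> Q i z} \<le> (1 + ln (\<beta> / \<alpha>) / ln \<theta>) * D"
proof -
  define n where "n = nat \<lceil>ln (\<beta> / \<alpha>) / ln \<theta>\<rceil>"
  have nonneg: "0 \<le> ln (\<beta> / \<alpha>) / ln \<theta>" using ab by simp
  then have n: "ln (\<beta> / \<alpha>) / ln \<theta> \<le> real n" "real n < 1 + ln (\<beta> / \<alpha>) / ln \<theta>"
    unfolding n_def by linarith+
  define E where "E k = {z \<in> space M. \<exists>i\<in>I. \<alpha> * \<theta> ^ k < g i z \<and> g i z \<le> \<theta> * (\<alpha> * \<theta> ^ k) \<and> Q i z}" for k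
  have top: "\<beta> \<le> \<alpha> * \<theta> ^ n"
  proof -
    have "ln (\<beta> / \<alpha>) \<le> real n * ln \<theta>" using n(1) ab by (simp add: field_simps)
    then have "exp (ln (\<beta> / \<alpha>)) \<le> exp (real n * ln \<theta>)" by (subst exp_le_cancel_iff)
    then have "\<beta> / \<alpha> \<le> exp (real n * ln \<theta>)" using ab by simp
    also have "\<dots> = \<theta> ^ n" using ab by (simp add: exp_of_nat_mult)
    finally show ?thesis using ab by (simp add: field_simps)
  qed
  have "{z \<in> space M. \<exists>i\<in>I. \<alpha> < g i z \<and> g i z \<le> \<beta> \<and> Q i z} \<subseteq> (\<Union>k\<in>{..<n}. E k)"
  proof safe
    fix z i assume z: "z \<in> space M" "i \<in> I" "\<alpha> < g i z" "g i z \<le> \<beta>" "Q i z"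
    have "\<exists>k<n. \<alpha> * \<theta> ^ k < v \<and> v \<le> \<theta> * (\<alpha> * \<theta> ^ k)" if "\<alpha> < v" "v \<le> \<alpha> * \<theta> ^ n" for v n
      using that
    proof (induction n)
      case (Suc n)
      show ?case
      proof (cases "v \<le> \<alpha> * \<theta> ^ n")
        case True
        with Suc show ?thesis using less_Suc_eq by blast
      next
        case False
        with Suc.prems show ?thesis by (intro exI[of _ n]) (auto simp: mult_ac)
      qed
    qed auto
    from this[of "g i z" n] z top obtain k where
      "k < n" "\<alpha> * \<theta> ^ k < g i z" "g i z \<le> \<theta> * (\<alpha> * \<theta> ^ k)" by force
    with z show "z \<in> (\<Union>k\<in>{..<n}. E k)" by (auto simp: E_def)
  qed
  then have "prob {z \<in> space M. \<exists>i\<in>I. \<alpha> < g i z \<and> g i z \<le> \<beta> \<and> Q i z} \<le> prob (\<Union>k\<in>{..<n}. E k)"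
    by (rule finite_measure_mono) (use meas in \<open>auto simp: E_def\<close>)
  also have "\<dots> \<le> (\<Sum>k\<in>{..<n}. prob (E k))"
    by (rule finite_measure_subadditive_finite) (use meas in \<open>auto simp: E_def\<close>)
  also have "\<dots> \<le> (\<Sum>k\<in>{..<n}. D)"
  proof (rule sum_mono)
    fix k assume k: "k \<in> {..<n}"
    have "\<alpha> * 1 \<le> \<alpha> * \<theta> ^ k" using ab by (intro mult_left_mono) auto
    moreover have "\<alpha> * \<theta> ^ k \<le> \<beta>"
    proof -
      have "real k < ln (\<beta> / \<alpha>) / ln \<theta>" using k unfolding n_def by (simp add: less_ceiling_iff nat_less_iff zless_nat_eq_int_zless)
      then have "real k * ln \<theta> \<le> ln (\<beta> / \<alpha>)" using ab by (simp add: field_simps)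
      then have "exp (real k * ln \<theta>) \<le> exp (ln (\<beta> / \<alpha>))" by (subst exp_le_cancel_iff)
      then have "\<theta> ^ k \<le> \<beta> / \<alpha>" using ab by (simp add: exp_of_nat_mult)
      then show ?thesis using ab by (simp add: field_simps)
    qed
    ultimately show "prob (E k) \<le> D" unfolding E_def by (intro block) auto
  qed
  also have "\<dots> = real n * D" by simp
  also have "\<dots> \<le> (1 + ln (\<beta> / \<alpha>) / ln \<theta>) * D"
  \<comment> \<open>The number \<open>n\<close> of blocks may be 0, so the sign of \<open>D\<close>
    is read off from the block bound at \<open>\<alpha>\<close>.\<close>
  proof (rule mult_right_mono)
    show "0 \<le> D" using order_trans[OF measure_nonneg block[of \<alpha>]] ab by simp
  qed (use n in auto)
  finally show ?thesis .
qed

text \<open>The exponential parameter \<open>r\<close> may vary with the expected count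
  \<open>\<kappa> = real m * a\<close> of a block; only the resulting exponent
  \<open>\<gamma>\<close> has to be uniform. The last block can reach up to
  \<open>\<theta> * \<beta>\<close>, hence the condition on \<open>B\<close>.\<close>

lemma upper_region:
  fixes \<alpha> \<beta> \<theta> B x \<gamma> :: real
  assumes "0 < \<alpha>" "\<alpha> \<le> \<beta>" "1 < \<theta>" "\<theta> * \<beta> \<le> B" "B < 1" "0 \<le> x"
    and rate: "\<And>\<kappa>. real m * \<alpha> \<le> \<kappa> \<Longrightarrow> \<exists>r\<ge>0. \<kappa> * (exp r - 1 - r) - r * (x * sqrt ((1 - B) / \<theta>)) * sqrt \<kappa> \<le> - \<gamma>"
  shows "measure (H0_law m) {z \<in> space (H0_law m).
      \<exists>i\<in>{1..m}. \<alpha> < z i \<and> z i \<le> \<beta> \<and> exceeds m x z i}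
    \<le> (1 + ln (\<beta> / \<alpha>) / ln \<theta>) * (2 * exp (- \<gamma>))"
proof -
  interpret P: prob_space "H0_law m" by (rule prob_space_H0_law)
  show ?thesis
  proof (rule P.prob_geometric_cover[where g = "\<lambda>i z. z i"])
    fix a :: real
    show "{z \<in> space (H0_law m). \<exists>i\<in>{1..m}. a < z i \<and> z i \<le> \<theta> * a \<and> exceeds m x z i} \<in> P.events"
      by (intro sets_H0_intros)
    assume a: "\<alpha> \<le> a" "a \<le> \<beta>"
    then obtain r where r: "0 \<le> r"
      "real m * a * (exp r - 1 - r) - r * (x * sqrt ((1 - B) / \<theta>)) * sqrt (real m * a) \<le> - \<gamma>"
      using rate[OF mult_left_mono[OF a(1) of_nat_0_le_iff]] by blast
    have "\<theta> * a \<le> \<theta> * \<beta>" using a assms by (intro mult_left_mono) auto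
    then have "\<theta> * a \<le> B" using assms by linarith
    then have "P.prob {z \<in> space (H0_law m). \<exists>i\<in>{1..m}. a < z i \<and> z i \<le> \<theta> * a \<and> exceeds m x z i}
        \<le> 2 * exp (real m * a * (exp r - 1 - r) - r * (x * sqrt ((1 - B) / \<theta>)) * sqrt (real m * a))"
      by (intro upper_block_exceeds) (use assms a r in auto)
    also have "\<dots> \<le> 2 * exp (- \<gamma>)" using r by simp
    finally show "P.prob {z \<in> space (H0_law m). \<exists>i\<in>{1..m}. a < z i \<and> z i \<le> \<theta> * a \<and> exceeds m x z i}
        \<le> 2 * exp (- \<gamma>)" .
  qed (use assms in auto)
qed

lemma lower_region:
  fixes \<alpha> \<beta> \<theta> B x :: real
  assumes "0 < \<alpha>" "\<alpha> \<le> \<beta>" "1 < \<theta>" "\<theta> * \<beta> \<le> B" "B < 1" "0 \<le> x" "0 < m"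
  shows "measure (H0_law m) {z \<in> space (H0_law m).
      \<exists>i\<in>{1..m}. \<alpha> < 1 - z i \<and> 1 - z i \<le> \<beta> \<and> exceeds m x z i}
    \<le> (1 + ln (\<beta> / \<alpha>) / ln \<theta>) * (2 * exp (- ((1 - B) / \<theta> * x\<^sup>2 / 2)))"
proof -
  interpret P: prob_space "H0_law m" by (rule prob_space_H0_law)
  show ?thesis
  proof (rule P.prob_geometric_cover[where g = "\<lambda>i z. 1 - z i"])
    fix a :: real
    show "{z \<in> space (H0_law m). \<exists>i\<in>{1..m}. a < 1 - z i \<and> 1 - z i \<le> \<theta> * a \<and> exceeds m x z i} \<in> P.events"
      by (intro sets_H0_intros)
    assume a: "\<alpha> \<le> a" "a \<le> \<beta>"
    have "\<theta> * a \<le> \<theta> * \<beta>" using a assms by (intro mult_left_mono) auto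
    then have "\<theta> * a \<le> B" using assms by linarith
    then show "P.prob {z \<in> space (H0_law m). \<exists>i\<in>{1..m}. a < 1 - z i \<and> 1 - z i \<le> \<theta> * a \<and> exceeds m x z i}
        \<le> 2 * exp (- ((1 - B) / \<theta> * x\<^sup>2 / 2))"
      by (intro lower_block_exceeds) (use assms a in auto)
  qed (use assms in auto)
qed

text \<open>For \<open>r \<le> 1\<close> the rate is at most
  \<open>\<kappa> * r\<^sup>2 - r * y * sqrt \<kappa>\<close>, minimal at
  \<open>y / (2 * sqrt \<kappa>)\<close>. If that point is beyond 1, then \<open>r = 1\<close>
  leaves the second, linear branch: the Poisson regime of small \<open>\<kappa>\<close>.\<close>

lemma poisson_rate_crude:
  fixes \<kappa> y :: real
  assumes "0 < \<kappa>" "0 \<le> y"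
  shows "\<exists>r\<ge>0. \<kappa> * (exp r - 1 - r) - r * y * sqrt \<kappa> \<le> - min (y\<^sup>2 / 4) (y * sqrt \<kappa> / 2)"
proof -
  define r where "r = min 1 (y / (2 * sqrt \<kappa>))"
  have r: "0 \<le> r" "r \<le> 1" using assms by (auto simp: r_def)
  have "exp r - 1 - r \<le> r\<^sup>2" using exp_bound[OF r] by simp
  then have "\<kappa> * (exp r - 1 - r) \<le> \<kappa> * r\<^sup>2" using assms by (intro mult_left_mono) auto
  moreover have "\<kappa> * r\<^sup>2 - r * y * sqrt \<kappa> \<le> - min (y\<^sup>2 / 4) (y * sqrt \<kappa> / 2)"
  proof (cases "y / (2 * sqrt \<kappa>) \<le> 1")
    case True
    then have r_eq: "r = y / (2 * sqrt \<kappa>)" by (simp add: r_def)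
    have "\<kappa> * r\<^sup>2 = y\<^sup>2 / 4" "r * y * sqrt \<kappa> = y\<^sup>2 / 2"
      using assms by (simp_all add: r_eq power_divide power_mult_distrib power2_eq_square)
    then show ?thesis by simp
  next
    case False
    then have "r = 1" by (simp add: r_def)
    moreover have "sqrt \<kappa> * (2 * sqrt \<kappa>) \<le> sqrt \<kappa> * y"
      using False assms by (intro mult_left_mono) (auto simp: field_simps)
    then have "2 * (sqrt \<kappa> * sqrt \<kappa>) \<le> y * sqrt \<kappa>" by (simp only: mult_ac)
    then have "2 * \<kappa> \<le> y * sqrt \<kappa>" using assms by simp
    ultimately show ?thesis by simp
  qed
  ultimately show ?thesis using r(1) by (intro exI[of _ r]) auto
qed

text \<open>The Gaussian choice \<open>r = y / sqrt \<kappa>\<close> is at most \<open>e\<close>, so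
  the second-order Taylor remainder is at most \<open>exp e * r\<^sup>2 / 2\<close>. The exponent
  approaches the Gaussian \<open>y\<^sup>2 / 2\<close> as \<open>e\<close> tends to 0.\<close>

lemma poisson_rate_sharp:
  fixes \<kappa> y e :: real
  assumes "0 < \<kappa>" "0 \<le> y" "y \<le> e * sqrt \<kappa>"
  shows "\<exists>r\<ge>0. \<kappa> * (exp r - 1 - r) - r * y * sqrt \<kappa> \<le> - (y\<^sup>2 / 2 * (2 - exp e))"
proof -
  define r where "r = y / sqrt \<kappa>"
  have r: "0 \<le> r" "r \<le> e" using assms by (auto simp: r_def field_simps)
  obtain t where t: "\<bar>t\<bar> \<le> \<bar>r\<bar>" "exp r = (\<Sum>m<2. r ^ m / fact m) + exp t / fact 2 * r ^ 2"
    using Maclaurin_exp_le[of r 2] by blast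
  then have "exp r - 1 - r = exp t * r\<^sup>2 / 2" by (simp add: numeral_2_eq_2)
  also have "\<dots> \<le> exp e * r\<^sup>2 / 2" using t r by (intro divide_right_mono mult_right_mono) auto
  finally have "\<kappa> * (exp r - 1 - r) \<le> \<kappa> * (exp e * r\<^sup>2 / 2)"
    using assms by (intro mult_left_mono) auto
  moreover have "\<kappa> * r\<^sup>2 = y\<^sup>2" "r * y * sqrt \<kappa> = y\<^sup>2"
    using assms by (auto simp: r_def power_divide power2_eq_square)
  moreover have "\<kappa> * (exp e * r\<^sup>2 / 2) = exp e * (\<kappa> * r\<^sup>2) / 2" by simp
  ultimately have "\<kappa> * (exp r - 1 - r) \<le> exp e * y\<^sup>2 / 2" "r * y * sqrt \<kappa> = y\<^sup>2" by metis+
  moreover have "- (y\<^sup>2 / 2 * (2 - exp e)) = exp e * y\<^sup>2 / 2 - y\<^sup>2" by (simp add: field_simps)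
  ultimately have "\<kappa> * (exp r - 1 - r) - r * y * sqrt \<kappa> \<le> - (y\<^sup>2 / 2 * (2 - exp e))" by linarith
  then show ?thesis using r(1) by blast
qed

section \<open>The type I error\<close>

lemma measure_PiM_component:
  assumes I: "finite I" "i \<in> I" and M: "\<And>i. i \<in> I \<Longrightarrow> prob_space (M i)" and S: "S \<in> sets (M i)"
  shows "measure (PiM I M) {z \<in> space (PiM I M). z i \<in> S} = measure (M i) S"
proof -
  let ?A = "\<lambda>j. if j = i then S else space (M j)"
  have "{z \<in> space (PiM I M). z i \<in> S} = PiE I ?A"
  proof (intro set_eqI iffI, goal_cases)
    case (2 z)
    then have z: "z \<in> PiE I ?A" .
    have "z j \<in> space (M j)" if "j \<in> I" for j
      using PiE_mem[OF z that] sets.sets_into_space[OF S] by (auto split: if_splits)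
    with z I PiE_mem[OF z I(2)] show ?case
      by (simp add: space_PiM PiE_iff)
  qed (auto simp: space_PiM PiE_iff)
  then have "measure (PiM I M) {z \<in> space (PiM I M). z i \<in> S} = (\<Prod>j\<in>I. measure (M j) (?A j))"
    using measure_PiM_PiE[OF I(1) M, where A = ?A] S by auto
  also have "\<dots> = measure (M i) S * (\<Prod>j\<in>I - {i}. measure (M j) (space (M j)))"
    using I by (subst prod.remove[of _ i]) auto
  also have "(\<Prod>j\<in>I - {i}. measure (M j) (space (M j))) = 1"
    using prob_space.prob_space[OF M] by (intro prod.neutral) auto
  finally show ?thesis by simp
qed

lemma order_stat_witness:
  assumes "t \<in> {1..m}"
  shows "\<exists>i\<in>{1..m}. order_stat m z t = z i"
proof -
  have "sort (map z [1..<Suc m]) ! (t - 1) \<in> set (sort (map z [1..<Suc m]))"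
    using assms by (intro nth_mem) auto
  then show ?thesis by (auto simp: order_stat_def)
qed

lemma card_le_order_stat_iff:
  assumes "t \<in> {1..m}"
  shows "order_stat m z t \<le> x \<longleftrightarrow> t \<le> card {i \<in> {1..m}. z i \<le> x}"
proof -
  have "(\<Sum>i\<in>{1..m}. if z i \<le> x then 1 else 0 :: real) = real (card {i \<in> {1..m}. z i \<le> x})"
    by (simp add: sum.If_cases Int_def)
  then show ?thesis using order_stat_le_iff[OF assms, of z x] by simp
qed

text \<open>If the maximum is attained at \<open>t\<close>, then the \<open>t\<close>-th order
  statistic is some \<open>z i\<close>, and at least \<open>t\<close> observations are at most
  \<open>z i\<close>; ties only increase this number. Values in \<open>(0, 1)\<close> make it
  possible to clear the denominator.\<close>

lemma HC_star_ge_imp_exceeds: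
  assumes z: "\<And>i. i \<in> {1..m} \<Longrightarrow> 0 < z i \<and> z i < 1" and m: "1 \<le> m" and x: "x \<le> HC_star m z"
  shows "\<exists>i\<in>{1..m}. exceeds m x z i"
proof -
  have "HC_star m z \<in> HC m z ` {1..m}" unfolding HC_star_def using m by (intro Max_in) auto
  with x obtain t where t: "t \<in> {1..m}" "x \<le> HC m z t" by auto
  obtain i where i: "i \<in> {1..m}" "order_stat m z t = z i" using order_stat_witness[OF t(1)] by blast
  have u: "0 < z i" "z i < 1" using z[OF i(1)] by auto
  have le: "real t \<le> real (card {j \<in> {1..m}. z j \<le> z i})"
    using card_le_order_stat_iff[OF t(1), of z "z i"] i(2) by simp
  define v where "v = sqrt (z i * (1 - z i))"
  have v: "0 < v" using u by (simp add: v_def)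
  have sm: "0 < sqrt (real m)" "sqrt (real m) * sqrt (real m) = real m" using m by auto
  have "x \<le> sqrt (real m) * (real t / real m - z i) / v"
    using t(2) by (simp add: HC_def i(2) v_def)
  then have "x * v \<le> sqrt (real m) * (real t / real m - z i)"
    using v by (simp add: pos_le_divide_eq)
  then have "sqrt (real m) * (x * v) \<le> sqrt (real m) * (sqrt (real m) * (real t / real m - z i))"
    using sm by (intro mult_left_mono) auto
  also have "\<dots> = real m * (real t / real m - z i)"
    using sm(2) by (simp only: mult.assoc[symmetric])
  also have "\<dots> = real t - real m * z i" using m by (simp add: field_simps)
  finally have "real m * z i + x * (sqrt (real m) * v) \<le> real t" by (simp add: mult_ac)
  moreover have "sqrt (real m) * v = sqrt (real m * z i * (1 - z i))"
    by (simp add: v_def real_sqrt_mult mult.assoc)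
  ultimately have "exceeds m x z i" using le by (simp add: exceeds_def)
  then show ?thesis using i(1) by blast
qed

text \<open>The first summand accounts for observations in \<open>(0, 1 / (x m)]\<close>, the second for
  \<open>(1 / (x m), x\<^sup>2 / (e\<^sup>2 m)]\<close>, the third for \<open>(x\<^sup>2 / (e\<^sup>2 m), e]\<close> and \<open>(1 - e, 1)\<close>, the last for
  \<open>(e, 1 - e]\<close>. Observations above \<open>1 - 1 / m\<close> cannot exceed, since \<open>N u \<le> m\<close>.\<close>

lemma type_I_bound:
  fixes x e :: real
  defines "C \<equiv> (1 - e * (1 + e)) / (1 + e)"
  assumes m: "1 \<le> m" and e: "0 < e" "e < 1 / 2"
    and x: "1 \<le> x" "1 < x\<^sup>2 * (1 - e)" and xm: "x\<^sup>2 \<le> e ^ 3 * real m" and em: "1 \<le> e * real m"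
  shows "measure (H0_law m) {z \<in> space (H0_law m). x \<le> HC_star m z}
    \<le> 1 / x + (1 + ln (x ^ 3 / e\<^sup>2) / ln (1 + e)) * (2 * exp (- min (C * x\<^sup>2 / 4) (sqrt C * sqrt x / 2)))
      + (1 + ln (real m) / ln (1 + e)) * (4 * exp (- (C * x\<^sup>2 / 2 * (2 - exp e))))
      + (1 + ln ((1 - e) / e) / ln (1 + e)) * (2 * exp (- (e\<^sup>2 / (1 + e) * x\<^sup>2 / 4)))"
proof -
  interpret P: prob_space "H0_law m" by (rule prob_space_H0_law)
  have e2: "e * e \<le> e / 2" using e by simp
  have "0 < 1 - e * (1 + e)" unfolding distrib_left using e e2 by linarith
  then have eB: "(1 + e) * e < 1" by (simp add: mult.commute)
  have "0 < e * (1 + e)" using e by simp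
  then have "1 - e * (1 + e) \<le> 1 + e" using e by linarith
  with \<open>0 < 1 - e * (1 + e)\<close> have C: "0 < C" "C \<le> 1" "(1 - (1 + e) * e) / (1 + e) = C"
    using e by (simp_all add: C_def mult.commute)
  have ge: "1 < exp e" using e by simp
  define Q where "Q a b z \<longleftrightarrow> (\<exists>i\<in>{1..m}. a < z i \<and> z i \<le> b \<and> exceeds m x z i)" for a b :: real and z
  define R where "R a b z \<longleftrightarrow> (\<exists>i\<in>{1..m}. a < 1 - z i \<and> 1 - z i \<le> b \<and> exceeds m x z i)" for a b :: real and z
  define E where "E P = {z \<in> space (H0_law m). P z}" for P
  have meas: "E (Q a b) \<in> sets (H0_law m)" "E (R a b) \<in> sets (H0_law m)" for a b
    unfolding E_def Q_def R_def by ((rule sets_H0_bex, intro sets_H0_intros; assumption)+)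
  define a0 where "a0 = 1 / (x * real m)"
  define a1 where "a1 = x\<^sup>2 / (e\<^sup>2 * real m)"
  have a0: "0 < a0" "real m * a0 = 1 / x" using m x by (auto simp: a0_def)
  have a01: "a0 \<le> a1"
  proof -
    have "e\<^sup>2 * 1 \<le> 1 * x ^ 3" using e x by (intro mult_mono power_le_one one_le_power) auto
    then have "e\<^sup>2 * real m \<le> x ^ 3 * real m" using m by (intro mult_right_mono) auto
    then show ?thesis unfolding a0_def a1_def using m x e
      by (simp add: divide_simps power2_eq_square power3_eq_cube mult_ac)
  qed
  have a1: "a1 \<le> e"
    using xm m e by (simp add: a1_def divide_simps power2_eq_square power3_eq_cube mult_ac)
  \<comment> \<open>\<open>?B\<close> has probability at most \<open>real m * a0 = 1 / x\<close>,
    and \<open>?T\<close> is a null event. Off both, all observations lie strictly between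
    \<open>a0\<close> and 1, away from the convention for division by 0.\<close>
  let ?B = "E (\<lambda>z. \<exists>i\<in>{1..m}. z i \<in> {..a0})" and ?T = "E (\<lambda>z. \<exists>i\<in>{1..m}. z i \<in> {1 - 0..})"
  have Bsets: "E (\<lambda>z. z i \<in> {..a0}) \<in> sets (H0_law m)" "E (\<lambda>z. z i \<in> {1 - 0..}) \<in> sets (H0_law m)"
    if "i \<in> {1..m}" for i
    using that unfolding E_def atMost_iff atLeast_iff by (intro sets_H0_intros; assumption)+
  have BT: "?B \<in> sets (H0_law m)" "?T \<in> sets (H0_law m)"
    using Bsets unfolding E_def by (intro sets_H0_bex; simp)+
  have comp: "measure (H0_law m) (E (\<lambda>z. z i \<in> S)) = measure (uniform_law 1) S"
    if "i \<in> {1..m}" "S \<in> sets borel" for i S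
    unfolding H0_law_def E_def
    using measure_PiM_component[of "{1..m}" i "\<lambda>_. uniform_law 1" S] that prob_space_uniform_law by simp
  have "1 / (x * real m) \<le> 1" using m x mult_mono[of 1 x 1 "real m"] by (simp add: divide_simps)
  then have a0le: "a0 \<le> 1" by (simp add: a0_def)
  have "P.prob ?B \<le> (\<Sum>i\<in>{1..m}. P.prob (E (\<lambda>z. z i \<in> {..a0})))"
  proof -
    have "?B = (\<Union>i\<in>{1..m}. E (\<lambda>z. z i \<in> {..a0}))" by (auto simp: E_def)
    then show ?thesis
      using Bsets by (auto intro!: P.finite_measure_subadditive_finite)
  qed
  also have "\<dots> = (\<Sum>i\<in>{1..m}. a0)"
    using a0 a0le by (intro sum.cong refl, subst comp) (auto intro!: measure_uniform_law_atMost)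
  finally have B: "P.prob ?B \<le> 1 / x" using a0 by simp
  have "P.prob ?T \<le> (\<Sum>i\<in>{1..m}. P.prob (E (\<lambda>z. z i \<in> {1 - 0..})))"
  proof -
    have "?T = (\<Union>i\<in>{1..m}. E (\<lambda>z. z i \<in> {1 - 0..}))" by (auto simp: E_def)
    then show ?thesis
      using Bsets by (auto intro!: P.finite_measure_subadditive_finite)
  qed
  also have "\<dots> = 0"
  proof (rule sum.neutral, safe)
    fix i assume i: "i \<in> {1..m}"
    have "{0..1} \<inter> {1 - 0..} = {1::real}" by auto
    then have "measure (uniform_law 1) {1 - 0..} = 0"
      unfolding uniform_law_def by (subst measure_uniform_measure) auto
    then show "P.prob (E (\<lambda>z. z i \<in> {1 - 0..})) = 0" using comp[OF i, of "{1 - 0..}"] by simp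
  qed
  finally have T: "P.prob ?T \<le> 0" .
  \<comment> \<open>Here \<open>\<kappa> \<ge> 1 / x\<close>, so the linear branch of the crude rate
    is at least \<open>sqrt C * sqrt x / 2\<close>. The number of blocks is logarithmic in
    \<open>a1 / a0 = x ^ 3 / e\<^sup>2\<close>.\<close>
  have Q1: "P.prob (E (Q a0 a1)) \<le> (1 + ln (x ^ 3 / e\<^sup>2) / ln (1 + e))
      * (2 * exp (- min (C * x\<^sup>2 / 4) (sqrt C * sqrt x / 2)))"
  proof -
    have "P.prob (E (Q a0 a1)) \<le> (1 + ln (a1 / a0) / ln (1 + e))
      * (2 * exp (- min (C * x\<^sup>2 / 4) (sqrt C * sqrt x / 2)))"
      unfolding E_def Q_def
    proof (rule upper_region[where B = "(1 + e) * e"])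
      fix \<kappa> assume k: "real m * a0 \<le> \<kappa>"
      have "0 < 1 / x" using x by simp
      with k have k0: "1 / x \<le> \<kappa>" "0 < \<kappa>" unfolding a0(2) by linarith+
      have "sqrt x = x * sqrt (1 / x)" using x by (simp add: real_sqrt_divide field_simps)
      also have "\<dots> \<le> x * sqrt \<kappa>" using k0 x by (intro mult_left_mono) auto
      finally have "sqrt C * sqrt x \<le> sqrt C * (x * sqrt \<kappa>)" using C by (intro mult_left_mono) auto
      also have "sqrt C * (x * sqrt \<kappa>) = x * sqrt C * sqrt \<kappa>" by simp
      finally have 1: "sqrt C * sqrt x / 2 \<le> x * sqrt C * sqrt \<kappa> / 2" by (rule divide_right_mono) simp
      have 2: "C * x\<^sup>2 / 4 \<le> (x * sqrt C)\<^sup>2 / 4" using C(1) by (simp add: power_mult_distrib)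
      have "min (C * x\<^sup>2 / 4) (sqrt C * sqrt x / 2) \<le> min ((x * sqrt C)\<^sup>2 / 4) (x * sqrt C * sqrt \<kappa> / 2)"
        by (rule min.mono[OF 2 1])
      moreover obtain r where "0 \<le> r"
        "\<kappa> * (exp r - 1 - r) - r * (x * sqrt C) * sqrt \<kappa> \<le> - min ((x * sqrt C)\<^sup>2 / 4) (x * sqrt C * sqrt \<kappa> / 2)"
        using poisson_rate_crude[of \<kappa> "x * sqrt C"] k0 x C(1) by auto
      ultimately show "\<exists>r\<ge>0. \<kappa> * (exp r - 1 - r) - r * (x * sqrt ((1 - (1 + e) * e) / (1 + e))) * sqrt \<kappa>
          \<le> - min (C * x\<^sup>2 / 4) (sqrt C * sqrt x / 2)"
        unfolding C(3) by (intro exI[of _ r]) linarith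
    qed (use a0 a01 a1 e eB x in auto)
    also have "a1 / a0 = x ^ 3 / e\<^sup>2"
      unfolding a0_def a1_def using m x e by (simp add: field_simps power2_eq_square power3_eq_cube)
    finally show ?thesis .
  qed
  \<comment> \<open>The choice of \<open>a1\<close> gives
    \<open>\<kappa> \<ge> (x / e)\<^sup>2\<close>, which is what the sharp rate requires of
    \<open>y = x * sqrt C\<close>.\<close>
  have Q2: "P.prob (E (Q a1 e)) \<le> (1 + ln (real m) / ln (1 + e)) * (2 * exp (- (C * x\<^sup>2 / 2 * (2 - exp e))))"
  proof -
    have "P.prob (E (Q a1 e)) \<le> (1 + ln (e / a1) / ln (1 + e)) * (2 * exp (- (C * x\<^sup>2 / 2 * (2 - exp e))))"
      unfolding E_def Q_def
    proof (rule upper_region[where B = "(1 + e) * e"])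
      fix \<kappa> assume k: "real m * a1 \<le> \<kappa>"
      have "real m * a1 = (x / e)\<^sup>2" using m by (simp add: a1_def power_divide)
      then have k1: "(x / e)\<^sup>2 \<le> \<kappa>" using k by simp
      have "0 < (x / e)\<^sup>2" using x e by simp
      then have k0: "0 < \<kappa>" using k1 by linarith
      have "x / e \<le> sqrt \<kappa>" using k1 by (intro real_le_rsqrt)
      then have "x \<le> e * sqrt \<kappa>" using e by (simp add: field_simps)
      moreover have "x * sqrt C \<le> x * 1" using C x by (intro mult_left_mono) auto
      ultimately have "x * sqrt C \<le> e * sqrt \<kappa>" by simp
      from poisson_rate_sharp[OF k0 _ this] x C
      show "\<exists>r\<ge>0. \<kappa> * (exp r - 1 - r) - r * (x * sqrt ((1 - (1 + e) * e) / (1 + e))) * sqrt \<kappa>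
          \<le> - (C * x\<^sup>2 / 2 * (2 - exp e))"
        unfolding C(3) by (simp add: power_mult_distrib mult.commute[of C])
    qed (use a0 a01 a1 e eB x in auto)
    also have "\<dots> \<le> (1 + ln (real m) / ln (1 + e)) * (2 * exp (- (C * x\<^sup>2 / 2 * (2 - exp e))))"
    proof (intro mult_right_mono add_mono divide_right_mono)
      have "e / a1 = e ^ 3 * real m / x\<^sup>2" using e x m by (simp add: a1_def field_simps power2_eq_square power3_eq_cube)
      also have "\<dots> \<le> 1 * real m / 1"
        using e x m by (intro frac_le mult_right_mono power_le_one) auto
      finally show "ln (e / a1) \<le> ln (real m)" using a0 a01 e m by simp
    qed (use e in auto)
    finally show ?thesis .
  qed
  \<comment> \<open>With \<open>B = (1 + e) * (1 - e)\<close> the factor \<open>1 - B\<close> is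
    \<open>e\<^sup>2\<close>, and \<open>x\<^sup>2 \<le> e ^ 3 * real m\<close> puts the crude rate
    into its Gaussian branch. The number of blocks depends on \<open>e\<close> alone.\<close>
  have Q3: "P.prob (E (Q e (1 - e))) \<le> (1 + ln ((1 - e) / e) / ln (1 + e))
      * (2 * exp (- (e\<^sup>2 / (1 + e) * x\<^sup>2 / 4)))"
    unfolding E_def Q_def
  proof (rule upper_region[where B = "(1 + e) * (1 - e)"])
    fix \<kappa> assume k: "real m * e \<le> \<kappa>"
    define y where "y = x * sqrt (e\<^sup>2 / (1 + e))"
    have y2: "y\<^sup>2 = e\<^sup>2 / (1 + e) * x\<^sup>2" using e by (simp add: y_def power_mult_distrib)
    have y0: "0 \<le> y" using x e by (simp add: y_def)
    have k0: "0 < \<kappa>" using k em by (simp add: mult.commute)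
    have eB: "1 - (1 + e) * (1 - e) = e\<^sup>2" by (simp add: power2_eq_square algebra_simps)
    have "e\<^sup>2 / (1 + e) \<le> 1 / 1" using e by (intro frac_le power_le_one) auto
    then have "e\<^sup>2 / (1 + e) * x\<^sup>2 \<le> 1 * x\<^sup>2" by (intro mult_right_mono) auto
    then have "y\<^sup>2 \<le> x\<^sup>2" by (simp add: y2)
    also have "\<dots> \<le> e ^ 3 * real m" by (rule xm)
    also have "\<dots> \<le> e ^ 1 * real m" using e by (intro mult_right_mono power_decreasing) auto
    also have "\<dots> \<le> \<kappa>" using k by (simp add: mult.commute)
    also have "\<dots> \<le> (2 * sqrt \<kappa>)\<^sup>2" using k0 by (simp add: power_mult_distrib)
    finally have "y \<le> 2 * sqrt \<kappa>" by (rule power2_le_imp_le) (use k0 in simp)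
    then have "y * (y / 2) \<le> y * sqrt \<kappa>" using y0 by (intro mult_left_mono) auto
    then have "y\<^sup>2 / 4 \<le> y * sqrt \<kappa> / 2" by (simp add: power2_eq_square)
    then have "min (y\<^sup>2 / 4) (y * sqrt \<kappa> / 2) = e\<^sup>2 / (1 + e) * x\<^sup>2 / 4" by (simp add: y2)
    then show "\<exists>r\<ge>0. \<kappa> * (exp r - 1 - r) - r * (x * sqrt ((1 - (1 + e) * (1 - e)) / (1 + e))) * sqrt \<kappa>
        \<le> - (e\<^sup>2 / (1 + e) * x\<^sup>2 / 4)"
      using poisson_rate_crude[OF k0 y0] unfolding eB y_def by simp
  qed (use e x in \<open>auto simp: algebra_simps\<close>)
  \<comment> \<open>The sub-Gaussian exponent is weakened by the factor
    \<open>2 - exp e < 1\<close>, so that this summand merges with that of \<open>Q2\<close> into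
    one with coefficient 4.\<close>
  have R1: "P.prob (E (R (1 / real m) e)) \<le> (1 + ln (real m) / ln (1 + e)) * (2 * exp (- (C * x\<^sup>2 / 2 * (2 - exp e))))"
  proof -
    have "P.prob (E (R (1 / real m) e)) \<le> (1 + ln (e / (1 / real m)) / ln (1 + e))
        * (2 * exp (- ((1 - (1 + e) * e) / (1 + e) * x\<^sup>2 / 2)))"
      unfolding E_def R_def
      by (rule lower_region) (use em e eB m x in \<open>auto simp: divide_le_eq\<close>)
    also have "\<dots> \<le> (1 + ln (real m) / ln (1 + e)) * (2 * exp (- (C * x\<^sup>2 / 2 * (2 - exp e))))"
    proof (intro mult_mono add_mono divide_right_mono)
      show "ln (e / (1 / real m)) \<le> ln (real m)" using e m by (simp add: mult_le_cancel_right1)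
      have "C * x\<^sup>2 / 2 * (2 - exp e) \<le> C * x\<^sup>2 / 2 * 1" using C ge by (intro mult_left_mono) auto
      then show "exp (- ((1 - (1 + e) * e) / (1 + e) * x\<^sup>2 / 2)) \<le> exp (- (C * x\<^sup>2 / 2 * (2 - exp e)))"
        unfolding C(3) by simp
    qed (use e m in auto)
    finally show ?thesis .
  qed
  have merge: "t \<le> a + b + p * (4 * q) + c" if "t \<le> a + 0 + b + p * (2 * q) + c + p * (2 * q)"
    for t a b c p q :: real
    using that by simp
  let ?U = "?B \<union> ?T \<union> E (Q a0 a1) \<union> E (Q a1 e) \<union> E (Q e (1 - e)) \<union> E (R (1 / real m) e)"
  have "{z \<in> space (H0_law m). x \<le> HC_star m z} \<subseteq> ?U"
  proof
    fix z assume "z \<in> {z \<in> space (H0_law m). x \<le> HC_star m z}"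
    then have z: "z \<in> space (H0_law m)" "x \<le> HC_star m z" by auto
    show "z \<in> ?U"
    proof (cases "z \<in> ?B \<union> ?T")
      case False
      then have rng: "a0 < z i \<and> z i < 1" if "i \<in> {1..m}" for i
        using that z(1) by (force simp: E_def not_le)
      then have "0 < z i \<and> z i < 1" if "i \<in> {1..m}" for i using that a0 by force
      from HC_star_ge_imp_exceeds[OF this m z(2)] obtain i where
        i: "i \<in> {1..m}" "exceeds m x z i" by blast
      let ?u = "z i"
      have u: "a0 < ?u" "?u < 1" using rng[OF i(1)] by auto
      consider "?u \<le> a1" | "a1 < ?u" "?u \<le> e" | "e < ?u" "?u \<le> 1 - e" | "1 - e < ?u" by linarith
      then show ?thesis
      proof cases
        \<comment> \<open>Since at most \<open>m\<close> observations are counted, an exceedance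
          forces \<open>x\<^sup>2 * z i \<le> real m * v\<close>. With \<open>z i > 1 - e\<close>
          and \<open>x\<^sup>2 * (1 - e) > 1\<close> this puts \<open>v\<close> above
          \<open>1 / real m\<close>, the lower end of the range of \<open>R\<close>.\<close>
        case 4
        define v where "v = 1 - ?u"
        have v: "0 < v" "v < e" using 4 u by (auto simp: v_def)
        have "real (card {j \<in> {1..m}. z j \<le> ?u}) \<le> real (card {1..m})"
          by (intro of_nat_mono card_mono) auto
        then have "x * sqrt (real m * ?u * (1 - ?u)) \<le> real m * v"
          using i(2) unfolding exceeds_def v_def by (simp add: algebra_simps)
        then have "(x * sqrt (real m * ?u * (1 - ?u)))\<^sup>2 \<le> (real m * v)\<^sup>2"
          using x u a0 by (intro power_mono) auto
        moreover have "(sqrt (real m * ?u * (1 - ?u)))\<^sup>2 = real m * ?u * v"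
          using u a0 by (subst real_sqrt_pow2) (auto simp: v_def)
        ultimately have "x\<^sup>2 * (real m * ?u * v) \<le> (real m * v)\<^sup>2"
          by (simp only: power_mult_distrib[of x])
        then have "x\<^sup>2 * ?u * (real m * v) \<le> (real m * v) * (real m * v)"
          by (simp only: power2_eq_square mult_ac)
        then have 5: "x\<^sup>2 * ?u \<le> real m * v" using v m by simp
        have "x\<^sup>2 * (1 - e) \<le> x\<^sup>2 * ?u" using 4 by (intro mult_left_mono) auto
        then have "1 / real m < v" using 5 x m by (simp add: field_simps)
        then show ?thesis using v i z(1) by (auto simp: E_def R_def v_def)
      qed (use u i z(1) in \<open>auto simp: E_def Q_def\<close>)
    qed auto
  qed
  then have "P.prob {z \<in> space (H0_law m). x \<le> HC_star m z} \<le> P.prob ?U"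
    by (rule P.finite_measure_mono) (use BT meas in auto)
  also have "\<dots> \<le> P.prob ?B + P.prob ?T + P.prob (E (Q a0 a1)) + P.prob (E (Q a1 e))
      + P.prob (E (Q e (1 - e))) + P.prob (E (R (1 / real m) e))"
    by (intro order_trans[OF measure_Un_le] add_mono order_refl sets.Un BT meas)
  also have "\<dots> \<le> 1 / x + 0
      + (1 + ln (x ^ 3 / e\<^sup>2) / ln (1 + e)) * (2 * exp (- min (C * x\<^sup>2 / 4) (sqrt C * sqrt x / 2)))
      + (1 + ln (real m) / ln (1 + e)) * (2 * exp (- (C * x\<^sup>2 / 2 * (2 - exp e))))
      + (1 + ln ((1 - e) / e) / ln (1 + e)) * (2 * exp (- (e\<^sup>2 / (1 + e) * x\<^sup>2 / 4)))
      + (1 + ln (real m) / ln (1 + e)) * (2 * exp (- (C * x\<^sup>2 / 2 * (2 - exp e))))"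
    by (intro add_mono B T Q1 Q2 Q3 R1)
  finally show ?thesis by (rule merge)
qed

text \<open>In \<open>type_I_bound\<close> the parameter \<open>e\<close> is fixed in terms of
  \<open>\<delta>\<close> alone. As \<open>e\<close> tends to 0, the coefficient of
  \<open>ln (ln m)\<close> in the critical exponent tends to \<open>1 + \<delta> / 2\<close>, so
  some \<open>e\<close> keeps it above \<open>1 + \<delta> / 4\<close>; the margin over 1 pays for
  the \<open>O(log m)\<close> blocks.\<close>

lemma type_I_limit:
  fixes \<delta> :: real
  assumes \<delta>: "\<delta> > 0"
  shows "(\<lambda>m. type_I_error m (HC_rejects \<delta> m)) \<longlonglongrightarrow> 0"
proof -
  let ?C = "\<lambda>e::real. (1 - e * (1 + e)) / (1 + e)"
  have "((\<lambda>e::real. (2 + \<delta>) / 2 * ?C e * (2 - exp e)) \<longlongrightarrow> (2 + \<delta>) / 2 * ?C 0 * (2 - exp 0)) (at_right 0)"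
    by (intro tendsto_intros) auto
  then have "\<forall>\<^sub>F e in at_right 0. 1 + \<delta> / 4 < (2 + \<delta>) / 2 * ?C e * (2 - exp e)"
    by (rule order_tendstoD) (use \<delta> in simp)
  moreover have "\<forall>\<^sub>F e::real in at_right 0. e \<in> {0<..<1/2}"
    by (rule eventually_at_right_real) simp
  ultimately have "\<forall>\<^sub>F e in at_right 0. 1 + \<delta> / 4 < (2 + \<delta>) / 2 * ?C e * (2 - exp e) \<and> e \<in> {0<..<1/2}"
    by (rule eventually_conj)
  then obtain e where e: "1 + \<delta> / 4 < (2 + \<delta>) / 2 * ?C e * (2 - exp e)" "0 < e" "e < 1 / 2"
    using eventually_happens[of _ "at_right (0::real)"] by (auto simp: trivial_limit_at_right_real)
  define C where "C = ?C e"
  have "e * e \<le> e / 2" using e by simp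
  then have "0 < 1 - e * (1 + e)" unfolding distrib_left using e by linarith
  then have C: "0 < C" using e by (simp add: C_def)
  define l where "l = ln (1 + e)"
  have l: "0 < l" using e by (simp add: l_def)
  define x where "x m = sqrt ((2 + \<delta>) * ln (ln (real m)))" for m
  have x_top: "filterlim x at_top sequentially" unfolding x_def using \<delta> by real_asymp
  have lnln: "\<forall>\<^sub>F m in sequentially. 0 \<le> ln (ln (real m))" by real_asymp
  have bound: "\<forall>\<^sub>F m in sequentially. type_I_error m (HC_rejects \<delta> m)
    \<le> 1 / x m + (1 + ln (x m ^ 3 / e\<^sup>2) / l) * (2 * exp (- min (C * (x m)\<^sup>2 / 4) (sqrt C * sqrt (x m) / 2)))
      + (1 + ln (real m) / l) * (4 * exp (- ((1 + \<delta> / 4) * ln (ln (real m)))))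
      + (1 + ln ((1 - e) / e) / l) * (2 * exp (- (e\<^sup>2 / (1 + e) * (x m)\<^sup>2 / 4)))"
  proof -
    have 1: "\<forall>\<^sub>F m in sequentially. 1 \<le> x m"
      using x_top by (simp add: filterlim_at_top)
    have 2: "\<forall>\<^sub>F m in sequentially. 1 < (2 + \<delta>) * ln (ln (real m)) * (1 - e)"
    proof -
      have "0 < 1 - e" using e by simp
      then show ?thesis using \<delta> by real_asymp
    qed
    have 3: "\<forall>\<^sub>F m in sequentially. (2 + \<delta>) * ln (ln (real m)) \<le> e ^ 3 * real m"
      using \<delta> e(2) by real_asymp
    have 4: "\<forall>\<^sub>F m in sequentially. 1 \<le> e * real m" using e(2) by real_asymp
    have 5: "\<forall>\<^sub>F m in sequentially. m \<ge> (1::nat)" by (rule eventually_ge_at_top)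
    show ?thesis
      using lnln 1 2 3 4 5
    proof eventually_elim
      case (elim m)
      have x2: "(x m)\<^sup>2 = (2 + \<delta>) * ln (ln (real m))"
        using \<delta> elim(1) by (simp add: x_def)
      have "type_I_error m (HC_rejects \<delta> m) = measure (H0_law m) {z \<in> space (H0_law m). x m \<le> HC_star m z}"
        by (simp add: type_I_error_def HC_rejects_def x_def)
      also have "\<dots> \<le> 1 / x m + (1 + ln (x m ^ 3 / e\<^sup>2) / ln (1 + e)) * (2 * exp (- min (?C e * (x m)\<^sup>2 / 4) (sqrt (?C e) * sqrt (x m) / 2)))
        + (1 + ln (real m) / ln (1 + e)) * (4 * exp (- (?C e * (x m)\<^sup>2 / 2 * (2 - exp e))))
        + (1 + ln ((1 - e) / e) / ln (1 + e)) * (2 * exp (- (e\<^sup>2 / (1 + e) * (x m)\<^sup>2 / 4)))"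
        by (rule type_I_bound) (use elim e x2 in simp_all)
      also have "\<dots> \<le> 1 / x m + (1 + ln (x m ^ 3 / e\<^sup>2) / l) * (2 * exp (- min (C * (x m)\<^sup>2 / 4) (sqrt C * sqrt (x m) / 2)))
      + (1 + ln (real m) / l) * (4 * exp (- ((1 + \<delta> / 4) * ln (ln (real m)))))
      + (1 + ln ((1 - e) / e) / l) * (2 * exp (- (e\<^sup>2 / (1 + e) * (x m)\<^sup>2 / 4)))"
        unfolding C_def[symmetric] l_def[symmetric]
      proof (intro add_mono order_refl mult_left_mono)
        have "(1 + \<delta> / 4) * ln (ln (real m)) \<le> ((2 + \<delta>) / 2 * C * (2 - exp e)) * ln (ln (real m))"
          using e(1) elim(1) unfolding C_def by (intro mult_right_mono) auto
        also have "\<dots> = C * (x m)\<^sup>2 / 2 * (2 - exp e)" by (simp add: x2)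
        finally show "exp (- (C * (x m)\<^sup>2 / 2 * (2 - exp e))) \<le> exp (- ((1 + \<delta> / 4) * ln (ln (real m))))"
          by simp
        show "0 \<le> 1 + ln (real m) / l" using elim l by simp
      qed auto
      finally show ?case .
    qed
  qed
  have lim1: "(\<lambda>m. 1 / x m) \<longlonglongrightarrow> 0"
    using x_top by (rule filterlim_compose[rotated]) real_asymp
  have lim2: "(\<lambda>m. (1 + ln (x m ^ 3 / e\<^sup>2) / l) * (2 * exp (- min (C * (x m)\<^sup>2 / 4) (sqrt C * sqrt (x m) / 2)))) \<longlonglongrightarrow> 0"
  proof (rule filterlim_compose[OF _ x_top])
    define s where "s = sqrt C"
    have s: "0 < s" using C by (simp add: s_def)
    have "0 < e\<^sup>2" using e by simp
    then show "((\<lambda>y. (1 + ln (y ^ 3 / e\<^sup>2) / l) * (2 * exp (- min (C * y\<^sup>2 / 4) (sqrt C * sqrt y / 2)))) \<longlongrightarrow> 0) at_top"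
      unfolding s_def[symmetric] using s C l by real_asymp
  qed
  \<comment> \<open>The critical summand. With \<open>y = ln (ln m)\<close> the number of blocks is
    of order \<open>exp y\<close>, which cancels one unit of the decay and leaves
    \<open>exp (- (d * y))\<close>.\<close>
  have lim3: "(\<lambda>m. (1 + ln (real m) / l) * (4 * exp (- ((1 + \<delta> / 4) * ln (ln (real m)))))) \<longlonglongrightarrow> 0"
  proof (rule Lim_transform_eventually)
    define d where "d = \<delta> / 4"
    have "0 < d" using \<delta> by (simp add: d_def)
    have decay: "((\<lambda>y. c * exp (- (k * y))) \<longlongrightarrow> 0) at_top" if "0 < k" "0 < c" for k c :: real
      using that by real_asymp
    have "((\<lambda>y. 4 * exp (- ((1 + d) * y)) + 4 / l * exp (- (d * y))) \<longlongrightarrow> 0 + 0) at_top"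
      using l \<open>0 < d\<close> by (intro tendsto_add decay) auto
    then have "((\<lambda>y. 4 * exp (- ((1 + d) * y)) + 4 / l * exp (- (d * y))) \<longlongrightarrow> 0) at_top"
      by simp
    moreover have "filterlim (\<lambda>m. ln (ln (real m))) at_top sequentially" by real_asymp
    ultimately show "(\<lambda>m. 4 * exp (- ((1 + d) * ln (ln (real m)))) + 4 / l * exp (- (d * ln (ln (real m))))) \<longlonglongrightarrow> 0"
      by (rule filterlim_compose)
    have "\<forall>\<^sub>F m in sequentially. 0 < ln (real m)" by real_asymp
    then show "\<forall>\<^sub>F m in sequentially. 4 * exp (- ((1 + d) * ln (ln (real m)))) + 4 / l * exp (- (d * ln (ln (real m))))
        = (1 + ln (real m) / l) * (4 * exp (- ((1 + \<delta> / 4) * ln (ln (real m)))))"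
    proof eventually_elim
      case (elim m)
      have "exp (- (d * ln (ln (real m)))) = ln (real m) * exp (- ((1 + d) * ln (ln (real m))))"
        using elim by (simp add: ring_distribs exp_add exp_minus exp_diff inverse_eq_divide)
      then show ?case unfolding d_def by (simp only: ring_distribs) simp
    qed
  qed
  have lim4: "(\<lambda>m. (1 + ln ((1 - e) / e) / l) * (2 * exp (- (e\<^sup>2 / (1 + e) * (x m)\<^sup>2 / 4)))) \<longlonglongrightarrow> (1 + ln ((1 - e) / e) / l) * 0"
  proof (intro tendsto_mult_left filterlim_compose[OF _ x_top])
    define s where "s = e\<^sup>2 / (1 + e)"
    have "0 < s" using e by (simp add: s_def)
    then show "((\<lambda>y. 2 * exp (- (e\<^sup>2 / (1 + e) * y\<^sup>2 / 4))) \<longlongrightarrow> 0) at_top"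
      unfolding s_def[symmetric] by real_asymp
  qed
  show ?thesis
  proof (rule tendsto_sandwich[OF _ bound tendsto_const])
    show "\<forall>\<^sub>F m in sequentially. 0 \<le> type_I_error m (HC_rejects \<delta> m)"
      by (simp add: type_I_error_def)
  qed (use tendsto_add[OF tendsto_add[OF tendsto_add[OF lim1 lim2] lim3] lim4] in simp)
qed

section \<open>The type II error\<close>

text \<open>The quotient equals \<open>(c - w) / (1 - w)\<close> times
  \<open>sqrt ((1 - w) / w)\<close>, and for \<open>c \<le> 1\<close> both factors decrease in
  \<open>w\<close>. Hence \<open>HC\<close> at an order statistic below \<open>u\<close> is at least
  the standardized excess at the fixed level \<open>u\<close>.\<close>

lemma standardized_excess_antimono:
  fixes z u c :: real
  assumes "0 < z" "z \<le> u" "u < 1" "u \<le> c" "c \<le> 1"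
  shows "(c - u) / sqrt (u * (1 - u)) \<le> (c - z) / sqrt (z * (1 - z))"
proof -
  have eq: "(c - w) / sqrt (w * (1 - w)) = (c - w) / (1 - w) * sqrt ((1 - w) / w)" if "0 < w" "w < 1" for w
  proof -
    have "(1 - w) / sqrt (w * (1 - w)) = (sqrt (1 - w) * sqrt (1 - w)) / (sqrt w * sqrt (1 - w))"
      using that by (simp add: real_sqrt_mult)
    also have "\<dots> = sqrt ((1 - w) / w)"
      using that by (subst mult_divide_mult_cancel_right) (auto simp: real_sqrt_divide)
    finally have "sqrt ((1 - w) / w) = (1 - w) / sqrt (w * (1 - w))" ..
    then show ?thesis using that by simp
  qed
  have "(c - u) / (1 - u) * sqrt ((1 - u) / u) \<le> (c - z) / (1 - z) * sqrt ((1 - z) / z)"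
  proof (intro mult_mono)
    have "(c - z) * (1 - u) - (c - u) * (1 - z) = (1 - c) * (u - z)" by (simp add: algebra_simps)
    also have "\<dots> \<ge> 0" using assms by simp
    finally show "(c - u) / (1 - u) \<le> (c - z) / (1 - z)" using assms by (simp add: frac_le_eq divide_simps)
    have "(1 - u) / u \<le> (1 - z) / z" using assms by (intro frac_le) auto
    then show "sqrt ((1 - u) / u) \<le> sqrt ((1 - z) / z)" by simp
  qed (use assms in auto)
  then show ?thesis using eq[of u] eq[of z] assms by simp
qed

text \<open>All \<open>\<pi> t\<close> lie at or below \<open>u = 1 - v\<close>, so the number of
  observations above \<open>u\<close> has mean \<open>real m * v * (1 - \<epsilon>)\<close> instead
  of \<open>real m * v\<close>. A Chernoff bound shows that at least half of this deficit is present
  except on \<open>?G\<close>; then a single order statistic already pushes \<open>HC\<close> up to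
  \<open>x\<close>.\<close>

lemma type_II_bound:
  fixes \<epsilon> v x :: real and \<pi> :: "nat \<Rightarrow> real"
  assumes m: "1 \<le> m" and eps: "0 < \<epsilon>" "\<epsilon> < 1" and v: "0 < v" "v < 1"
    and \<pi>: "\<And>t. t \<in> {1..m} \<Longrightarrow> 0 < \<pi> t \<and> \<pi> t \<le> 1 - v"
    and x: "x \<le> \<epsilon> * sqrt (real m * v) / 2"
  shows "measure (H1_mix_law m \<epsilon> \<pi>) {z \<in> space (H1_mix_law m \<epsilon> \<pi>). \<not> x \<le> HC_star m z}
    \<le> exp (- (real m * v * \<epsilon>\<^sup>2 / 16))"
proof -
  define M where "M t = mixture \<epsilon> (uniform_law 1) (uniform_law (\<pi> t))" for t
  have law: "H1_mix_law m \<epsilon> \<pi> = PiM {1..m} M" unfolding H1_mix_law_def M_def ..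
  have M: "prob_space (M t)" if "t \<in> {1..m}" for t
    unfolding M_def using \<pi>[OF that] eps
    by (intro prob_space_mixture prob_space_uniform_law) auto
  have setsM: "sets (M t) = sets borel" for t by (simp add: M_def)
  interpret P: prob_space "PiM {1..m} M" by (rule prob_space_PiM) (rule M)
  have measM: "measure (M t) A = (1 - \<epsilon>) * measure (uniform_law 1) A + \<epsilon> * measure (uniform_law (\<pi> t)) A"
    if "t \<in> {1..m}" "A \<in> sets borel" for t A
  proof -
    interpret U: prob_space "uniform_law 1" by (rule prob_space_uniform_law) simp
    interpret V: prob_space "uniform_law (\<pi> t)" using \<pi>[OF that(1)] by (intro prob_space_uniform_law) auto
    have "emeasure (M t) A = ennreal (1 - \<epsilon>) * emeasure (uniform_law 1) A + ennreal \<epsilon> * emeasure (uniform_law (\<pi> t)) A"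
      unfolding M_def by (rule emeasure_mixture) (use that in auto)
    also have "\<dots> = ennreal ((1 - \<epsilon>) * measure (uniform_law 1) A + \<epsilon> * measure (uniform_law (\<pi> t)) A)"
      using eps by (simp add: U.emeasure_eq_measure V.emeasure_eq_measure ennreal_mult ennreal_plus)
    finally show ?thesis by (rule measure_eq_emeasure_eq_ennreal[rotated]) (use eps in simp)
  qed
  have uniform_Ioi: "measure (uniform_law a) {b<..} = 0" if "0 < a" "a \<le> b" for a b
  proof -
    have "{0..a} \<inter> {b<..} = {}" using that by auto
    then show ?thesis unfolding uniform_law_def using that by (subst measure_uniform_measure) auto
  qed
  have uniform_Iic: "measure (uniform_law a) {..0} = 0" if "0 < a" for a
  proof -
    have "{0..a} \<inter> {..0} = {0}" using that by auto
    then show ?thesis unfolding uniform_law_def using that by (subst measure_uniform_measure) auto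
  qed
  define u where "u = 1 - v"
  have u: "0 < u" "u < 1" using v by (auto simp: u_def)
  define w where "w = (1 - \<epsilon>) * v"
  have w: "0 < w" "w \<le> 1" using eps v by (auto simp: w_def mult_le_one)
  \<comment> \<open>Only the component \<open>uniform_law 1\<close> of the mixture charges
    \<open>{u<..}\<close>.\<close>
  have Mu: "measure (M t) {u<..} = w" if "t \<in> {1..m}" for t
    using measM[OF that, of "{u<..}"] measure_uniform_law_greaterThan[of u 1] uniform_Ioi[of "\<pi> t" u] \<pi>[OF that] v
    by (simp add: w_def u_def)
  \<comment> \<open>Halfway between the means \<open>real m * w\<close> under the mixture and
    \<open>real m * v\<close> under the null hypothesis.\<close>
  define c where "c = real m * v * (1 - \<epsilon> / 2)"
  \<comment> \<open>The minimiser of \<open>r\<^sup>2 - \<epsilon> * r / 2\<close>, to which the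
    exponent per unit of \<open>real m * v\<close> reduces; the minimum is
    \<open>- (\<epsilon>\<^sup>2 / 16)\<close>.\<close>
  define r where "r = \<epsilon> / 4"
  let ?S = "\<lambda>z. real (card {i \<in> {1..m}. z i \<in> {u<..}})"
  let ?G = "{z \<in> space (PiM {1..m} M). c \<le> ?S z}"
  \<comment> \<open>A null event. The order statistic used below is at most \<open>u < 1\<close>, so
    off \<open>?Z\<close> it lies in \<open>(0, 1)\<close>.\<close>
  let ?Z = "{z \<in> space (PiM {1..m} M). \<exists>i\<in>{1..m}. z i \<in> {..0}}"
  \<comment> \<open>With a single level the maximal inequality is the ordinary Chernoff
    bound.\<close>
  have "P.prob {z \<in> space (PiM {1..m} M). \<exists>j<1::nat. r * c \<le> (r * w) * ?S z / w}
      \<le> exp (- (r * c)) * (1 - w + w * exp (r * w / w)) ^ card {1..m}"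
    by (rule PiM_maximal_inequality[where A = "\<lambda>_. {u<..}" and W = "\<lambda>_. w"]) (use M Mu w setsM in auto)
  also have "{z \<in> space (PiM {1..m} M). \<exists>j<1::nat. r * c \<le> (r * w) * ?S z / w} = ?G"
    using w eps by (simp add: r_def)
  also have "(1 - w + w * exp (r * w / w)) ^ card {1..m} = (1 + w * (exp r - 1)) ^ m"
    using w by (simp add: algebra_simps)
  also have "exp (- (r * c)) * (1 + w * (exp r - 1)) ^ m \<le> exp (- (r * c)) * exp (real m * (w * (exp r - 1)))"
    using w eps by (intro mult_left_mono power_one_plus_le_exp) (auto intro!: add_nonneg_nonneg simp: r_def)
  also have "\<dots> = exp (real m * (w * (exp r - 1)) - r * c)" by (simp add: exp_add[symmetric])
  also have "\<dots> \<le> exp (- (real m * v * \<epsilon>\<^sup>2 / 16))"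
  proof -
    have r: "0 \<le> r" "r \<le> 1" using eps by (auto simp: r_def)
    have "exp r - 1 \<le> r + r\<^sup>2" using exp_bound[OF r] by simp
    then have "real m * (w * (exp r - 1)) \<le> real m * (w * (r + r\<^sup>2))"
      using w by (intro mult_left_mono) auto
    also have "\<dots> = real m * v * ((1 - \<epsilon>) * r + (1 - \<epsilon>) * r\<^sup>2)" by (simp add: w_def algebra_simps)
    also have "\<dots> \<le> real m * v * ((1 - \<epsilon>) * r + 1 * r\<^sup>2)"
      using eps v by (intro mult_left_mono add_mono mult_right_mono) auto
    finally have "real m * (w * (exp r - 1)) - r * c \<le> real m * v * ((1 - \<epsilon>) * r + 1 * r\<^sup>2) - r * c" by simp
    also have "\<dots> = - (real m * v * \<epsilon>\<^sup>2 / 16)"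
      by (simp add: r_def c_def field_simps power2_eq_square)
    finally show ?thesis by simp
  qed
  finally have G: "P.prob ?G \<le> exp (- (real m * v * \<epsilon>\<^sup>2 / 16))" .
  have Zi: "{z \<in> space (PiM {1..m} M). z i \<in> {..0}} \<in> P.events" if "i \<in> {1..m}" for i
    using that setsM by (intro sets_Collect_single') (auto simp: M_def)
  have Z0: "P.prob {z \<in> space (PiM {1..m} M). z i \<in> {..0}} = 0" if "i \<in> {1..m}" for i
  proof -
    have "P.prob {z \<in> space (PiM {1..m} M). z i \<in> {..0}} = measure (M i) {..0}"
      by (rule measure_PiM_component) (use that M setsM in auto)
    also have "\<dots> = 0" using measM[OF that, of "{..0}"] uniform_Iic[of 1] uniform_Iic[of "\<pi> i"] \<pi>[OF that] by simp
    finally show ?thesis .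
  qed
  have Zeq: "?Z = (\<Union>i\<in>{1..m}. {z \<in> space (PiM {1..m} M). z i \<in> {..0}})" by auto
  have "P.prob ?Z \<le> (\<Sum>i\<in>{1..m}. P.prob {z \<in> space (PiM {1..m} M). z i \<in> {..0}})"
    unfolding Zeq by (rule P.finite_measure_subadditive_finite) (use Zi in auto)
  also have "\<dots> = 0" using Z0 by (intro sum.neutral) auto
  finally have Z: "P.prob ?Z \<le> 0" .
  have GZ: "?G \<in> P.events" "?Z \<in> P.events"
  proof -
    show "?Z \<in> P.events" unfolding Zeq using Zi by (intro sets.finite_UN) auto
    have "(\<lambda>z. z i) \<in> borel_measurable (PiM {1..m} M)" if "i \<in> {1..m}" for i
      using measurable_component_singleton[OF that, of M] setsM by (simp cong: measurable_cong_sets)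
    then have "{z \<in> space (PiM {1..m} M). u < z i} \<in> P.events" if "i \<in> {1..m}" for i
      using that by (intro borel_measurable_less borel_measurable_const)
    then have "(\<lambda>z. \<Sum>i\<in>{1..m}. if u < z i then 1 else 0 :: real) \<in> borel_measurable (PiM {1..m} M)"
      by (intro borel_measurable_sum measurable_If borel_measurable_const)
    moreover have "?S z = (\<Sum>i\<in>{1..m}. if u < z i then 1 else 0)" for z
      by (simp add: sum.If_cases Int_def)
    ultimately have "?S \<in> borel_measurable (PiM {1..m} M)" by simp
    then show "?G \<in> P.events" by (intro borel_measurable_le borel_measurable_const)
  qed
  have "{z \<in> space (PiM {1..m} M). \<not> x \<le> HC_star m z} \<subseteq> ?G \<union> ?Z"
  proof (rule ccontr)
    assume "\<not> ?thesis"
    then obtain z where z: "z \<in> space (PiM {1..m} M)" "\<not> x \<le> HC_star m z"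
      and S: "?S z < c" and pos: "\<And>i. i \<in> {1..m} \<Longrightarrow> 0 < z i" by force
    define t where "t = card {i \<in> {1..m}. z i \<le> u}"
    have "real t + ?S z = real m"
      using card_le_plus_card_greater[of m z u] unfolding t_def greaterThan_iff
      by (metis of_nat_add)
    then have "real m - c < real t" using S by linarith
    moreover have "real m - c = real m * u + real m * v * \<epsilon> / 2" by (simp add: c_def u_def algebra_simps)
    ultimately have t_gt: "real m * u + real m * v * \<epsilon> / 2 < real t" by simp
    have "0 \<le> real m * u + real m * v * \<epsilon> / 2" using u v eps by simp
    then have "0 < t" using t_gt by simp
    moreover have "t \<le> m" using card_le_plus_card_greater[of m z u] by (simp add: t_def)
    ultimately have t: "t \<in> {1..m}" by simp
    have zu: "order_stat m z t \<le> u" using card_le_order_stat_iff[OF t] by (simp add: t_def)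
    have z0: "0 < order_stat m z t" using order_stat_witness[OF t, of z] pos by auto
    have tm: "u + v * \<epsilon> / 2 \<le> real t / real m" "real t / real m \<le> 1"
      using t_gt t m by (simp_all add: field_simps)
    have "0 \<le> v * \<epsilon> / 2" using v eps by simp
    with tm(1) have tu: "v * \<epsilon> / 2 \<le> real t / real m - u" "u \<le> real t / real m" by linarith+
    have "x \<le> \<epsilon> * sqrt (real m * v) / 2" by (rule x)
    also have "\<dots> = sqrt (real m) * ((v * \<epsilon> / 2) / sqrt v)"
    proof -
      have "(v * \<epsilon> / 2) / sqrt v = \<epsilon> / 2 * (v / sqrt v)" by simp
      also have "v / sqrt v = sqrt v" using v by (simp add: real_div_sqrt)
      finally have "(v * \<epsilon> / 2) / sqrt v = \<epsilon> / 2 * sqrt v" .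
      then show ?thesis unfolding real_sqrt_mult by (simp only:) simp
    qed
    also have "\<dots> \<le> sqrt (real m) * ((real t / real m - u) / sqrt (u * (1 - u)))"
    proof (intro mult_left_mono frac_le tu(1))
      have "u * v \<le> 1 * v" using u v by (intro mult_right_mono) auto
      then show "sqrt (u * (1 - u)) \<le> sqrt v" by (simp add: u_def)
    qed (use tu u v in auto)
    also have "\<dots> \<le> HC m z t"
      unfolding HC_def
      by (intro mult_left_mono standardized_excess_antimono) (use zu z0 tm tu u in auto)
    also have "\<dots> \<le> HC_star m z" unfolding HC_star_def using t by (intro Max_ge) auto
    finally show False using z(2) by simp
  qed
  then have "P.prob {z \<in> space (PiM {1..m} M). \<not> x \<le> HC_star m z} \<le> P.prob (?G \<union> ?Z)"
    by (rule P.finite_measure_mono[OF _ sets.Un[OF GZ]])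
  also have "\<dots> \<le> P.prob ?G + P.prob ?Z" using GZ by (rule measure_Un_le)
  finally show ?thesis using G Z unfolding law by simp
qed

text \<open>For \<open>v = real m powr (- q)\<close> and
  \<open>\<epsilon> = real m powr (- p)\<close> the product
  \<open>real m * v * \<epsilon>\<^sup>2\<close> is \<open>real m powr a\<close> with
  \<open>a = 1 - q - 2 * p > 0\<close>. This makes the Chernoff bound vanish, and
  \<open>real m powr (a / 2) / 2\<close> eventually exceeds the threshold of order
  \<open>sqrt (ln (ln m))\<close>.\<close>

lemma type_II_limit:
  fixes p q \<delta> :: real and \<pi> :: "nat \<Rightarrow> nat \<Rightarrow> real"
  assumes p: "0 < p" and q: "0 < q" and pq: "q + 2 * p < 1"
    and \<pi>: "\<And>m t. m \<ge> 3 \<Longrightarrow> t \<in> {1..m} \<Longrightarrow> 0 < \<pi> m t \<and> \<pi> m t \<le> 1 - real m powr (- q)"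
    and \<delta>: "0 < \<delta>"
  shows "(\<lambda>m. type_II_error m (real m powr (- p)) (\<pi> m) (HC_rejects \<delta> m)) \<longlonglongrightarrow> 0"
proof (rule tendsto_sandwich[OF _ _ tendsto_const])
  show "\<forall>\<^sub>F m in sequentially. 0 \<le> type_II_error m (real m powr (- p)) (\<pi> m) (HC_rejects \<delta> m)"
    by (simp add: type_II_error_def)
  define a where "a = 1 - q - 2 * p"
  have a: "0 < a" using pq by (simp add: a_def)
  show "(\<lambda>m. exp (- (real m powr a / 16))) \<longlonglongrightarrow> 0" using a by real_asymp
  have 1: "\<forall>\<^sub>F m in sequentially. sqrt ((2 + \<delta>) * ln (ln (real m))) \<le> real m powr (a / 2) / 2"
    using a \<delta> by real_asymp
  have 2: "\<forall>\<^sub>F m in sequentially. 3 \<le> (m::nat)" by (rule eventually_ge_at_top)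
  show "\<forall>\<^sub>F m in sequentially. type_II_error m (real m powr (- p)) (\<pi> m) (HC_rejects \<delta> m)
      \<le> exp (- (real m powr a / 16))"
    using 1 2
  proof eventually_elim
    case (elim m)
    let ?e = "real m powr (- p)" and ?v = "real m powr (- q)"
    have m: "1 < real m" using elim by simp
    have lt: "real m powr (- s) < 1" if "0 < s" for s
      using powr_less_mono[of "- s" 0 "real m"] that m by simp
    have pw: "real m * ?v * ?e\<^sup>2 = real m powr a"
    proof -
      have "?e\<^sup>2 = real m powr (- (2 * p))" by (simp add: power2_eq_square powr_add[symmetric])
      moreover have "real m * ?v = real m powr (1 + - q)" by (simp add: powr_mult_base)
      ultimately show ?thesis by (simp only: powr_add[symmetric]) (simp add: a_def)
    qed
    have "real m powr (a / 2) = sqrt (real m powr a)" using m by (simp add: powr_half_sqrt_powr)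
    also have "\<dots> = ?e * sqrt (real m * ?v)"
      unfolding pw[symmetric] using m by (simp add: real_sqrt_mult)
    finally have x: "sqrt ((2 + \<delta>) * ln (ln (real m))) \<le> ?e * sqrt (real m * ?v) / 2"
      using elim(1) by simp
    have "type_II_error m ?e (\<pi> m) (HC_rejects \<delta> m) \<le> exp (- (real m * ?v * ?e\<^sup>2 / 16))"
      unfolding type_II_error_def HC_rejects_def
      by (rule type_II_bound) (use elim m lt[OF p] lt[OF q] \<pi> x in auto)
    then show ?case by (simp add: pw)
  qed
qed

theorem theorem3p7:
  fixes p q \<delta> :: real
    and \<pi> :: "nat \<Rightarrow> nat \<Rightarrow> real"
  assumes "0 < p" "p < 1" "0 < q" "q < 1"
    and "\<And>m t. m \<ge> 3 \<Longrightarrow> t \<in> {1..m} \<Longrightarrow> 0 < \<pi> m t \<and> \<pi> m t \<le> 1"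
    and "q + 2 * p < 1"
    and "\<And>m t. m \<ge> 3 \<Longrightarrow> t \<in> {1..m} \<Longrightarrow> \<pi> m t < 1 - real m powr (- q)"
    and "\<delta> > 0"
  shows "(\<lambda>m. type_I_error m (HC_rejects \<delta> m)
            + type_II_error m (real m powr (- p)) (\<pi> m) (HC_rejects \<delta> m))
         \<longlonglongrightarrow> 0"
proof -
  have "(\<lambda>m. type_II_error m (real m powr (- p)) (\<pi> m) (HC_rejects \<delta> m)) \<longlonglongrightarrow> 0"
    by (rule type_II_limit) (use assms in \<open>auto intro: less_imp_le\<close>)
  with type_I_limit[OF \<open>\<delta> > 0\<close>] show ?thesis
    by (rule tendsto_add[where a = 0 and b = 0, simplified])
qed

end
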